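(* Let $P,Q\subset\mathbb{R}^m$ be rational polytopes such that $\operatorname{aff}(P)$ and $\operatorname{aff}(Q)$ meet in a single point $p_0\in P\cap Q$. Set $R=\operatorname{conv}(P\cup Q)$ and suppose that $\operatorname{aff}(R)\cap\mathbb{Z}^m$ is the $\mathbb{Z}$-affine hull of $(\operatorname{aff}(P)\cup\operatorname{aff}(Q))\cap\mathbb{Z}^m$. Furthermore let $k$ be the smallest positive integer such that $kp_0\in\mathbb{Z}^m$. Then the following are equivalent: (1) In at least one of $\mathcal{E}(P)$ or $\mathcal{E}(Q)$ the point $(kp_0,k)$ has height $\le 1$ over all facets (of $\operatorname{cone}(\mathcal{E}(P))$, respectively $\operatorname{cone}(\mathcal{E}(Q))$); (2) $\mathbb{E}_R=(1-T^{(kp_0,k)})\,\mathbb{E}_P\,\mathbb{E}_Q$.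
   Context: For a rational polytope $P\subset\mathbb{R}^m$ the Ehrhart monoid is $\mathcal{E}(P)=\{(x,k): k\in\mathbb{Z}_+,\ x\in kP\cap\mathbb{Z}^m\}\subset\mathbb{Z}^{m+1}$; it is a normal affine (finitely generated) monoid. The fine (multigraded) Ehrhart series of $P$ is the generating function $\mathbb{E}_P=\sum_{z\in\mathcal{E}(P)}T^z$ in indeterminates $T_1,\dots,T_{m+1}$, where $T^z=T_1^{z_1}\cdots T_{m+1}^{z_{m+1}}$. $\operatorname{aff}(A)$ is the affine subspace of $\mathbb{R}^m$ spanned by $A$, and $\operatorname{conv}$ denotes the convex hull. A subset $A$ of $\mathbb{Z}^m$ is the $\mathbb{Z}$-affine hull of $B\subset\mathbb{Z}^m$ if $A=\{a_1x_1+\dots+a_nx_n: n\ge1,\ x_1,\dots,x_n\in B,\ a_1,\dots,a_n\in\mathbb{Z},\ a_1+\dots+a_n=1\}$. For an affine monoid $M$ (finitely generated submonoid of some $\mathbb{Z}^r$), $\operatorname{gp}(M)$ is the subgroup generated by $M$ and $\operatorname{cone}(M)$ the real cone generated by $M$. For a facet $F$ of $\operatorname{cone}(M)$ and $x\in M$, the (lattice) height of $x$ over $F$ is the number of hyperplanes of $\mathbb{R}\operatorname{gp}(M)$ between $F$ and $x$ (including one through $x$) that are parallel to $F$, pass through points of the lattice $\operatorname{gp}(M)$, and do not contain $F$.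
   Formalization: It is additionally assumed that aff(R) contains a point of Z^m; otherwise the Z-affine hull hypothesis holds vacuously (both sides empty) and the equivalence can fail, e.g. for the two diagonals of the unit square centred at (0,0,1/2) in the plane z=1/2. *)

theory Defs
  imports
    "HOL-Analysis.Analysis"
    "HOL-Computational_Algebra.Formal_Power_Series"
    "HOL-Library.Poly_Mapping"
begin

definition rational_polytope :: "(real ^ 'm) set \<Rightarrow> bool" where
  "rational_polytope P \<longleftrightarrow>
     (\<exists>V. finite V \<and> (\<forall>v\<in>V. \<forall>i. v $ i \<in> \<rat>) \<and> P = convex hull V)"

definition vec_of_int :: "int ^ 'm \<Rightarrow> real ^ 'm" where
  "vec_of_int x = (\<chi> i. of_int (x $ i))"

abbreviation int_lattice :: "(real ^ 'm) set" where
  "int_lattice \<equiv> range vec_of_int"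

text \<open>The condition on \<open>n\<close> is implied by the coefficients summing to 1; in particular the hull of
  the empty set is empty.\<close>

definition int_affine_hull :: "'a::real_vector set \<Rightarrow> 'a set" where
  "int_affine_hull B =
     {(\<Sum>i<n. of_int (a i) *\<^sub>R x i) | (n::nat) (a :: nat \<Rightarrow> int) x.
        n \<ge> 1 \<and> (\<forall>i<n. x i \<in> B) \<and> (\<Sum>i<n. a i) = 1}"

text \<open>The lattice \<open>\<int>\<^sup>m\<^sup>+\<^sup>1\<close> is represented as pairs of a vector in \<open>\<int>\<^sup>m\<close> and an integer (the degree).\<close>

definition ehrhart_monoid :: "(real ^ 'm) set \<Rightarrow> ((int ^ 'm) \<times> int) set" where
  "ehrhart_monoid P = {(x, k). k \<ge> 0 \<and> vec_of_int x \<in> (\<lambda>p. of_int k *\<^sub>R p) ` P}"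

definition real_ehrhart_monoid :: "(real ^ 'm) set \<Rightarrow> ((real ^ 'm) \<times> real) set" where
  "real_ehrhart_monoid P = (\<lambda>(x, k). (vec_of_int x, of_int k)) ` ehrhart_monoid P"

text \<open>The series lives in \<open>\<int>[T\<^sub>1\<^sup>\<plusminus>\<^sup>1, \<dots>, T\<^sub>m\<^sup>\<plusminus>\<^sup>1][[T\<^sub>m\<^sub>+\<^sub>1]]\<close>: Laurent polynomials in the first \<open>m\<close> indeterminates
  are elements of the group ring of \<open>\<int>\<^sup>m\<close>, and the last indeterminate is \<^const>\<open>fps_X\<close>.\<close>

type_synonym 'm series = "((int ^ 'm) \<Rightarrow>\<^sub>0 int) fps"

definition monomial :: "(int ^ 'm) \<times> nat \<Rightarrow> 'm series" where
  "monomial = (\<lambda>(x, k). fps_const (Poly_Mapping.single x 1) * fps_X ^ k)"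

text \<open>For bounded \<open>P\<close> the sum is finite, and the coefficient at \<open>(x, k)\<close> is 1 or 0 according to
  membership in the Ehrhart monoid; see \<open>lookup_ehrhart_series\<close> below.\<close>

definition ehrhart_series :: "(real ^ 'm) set \<Rightarrow> 'm series" where
  "ehrhart_series P =
     Abs_fps (\<lambda>k. \<Sum>x | (x, int k) \<in> ehrhart_monoid P. Poly_Mapping.single x 1)"

lemma finite_bounded_vec_of_int:
  fixes B :: "(real ^ 'm) set"
  assumes "bounded B"
  shows "finite {x. vec_of_int x \<in> B}"
proof -
  obtain b where b: "\<And>y. y \<in> B \<Longrightarrow> norm y \<le> b"
    using assms by (auto simp: bounded_iff)
  have "x \<in> vec_lambda ` (UNIV \<rightarrow>\<^sub>E {- \<lceil>b\<rceil>..\<lceil>b\<rceil>})" if "vec_of_int x \<in> B" for x :: "int ^ 'm"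
  proof -
    have "\<bar>x $ i\<bar> \<le> \<lceil>b\<rceil>" for i
    proof -
      have "\<bar>real_of_int (x $ i)\<bar> \<le> b"
        using component_le_norm_cart[of "vec_of_int x" i] b[OF that]
        by (simp add: vec_of_int_def)
      then show ?thesis by linarith
    qed
    then have "(\<lambda>i. x $ i) \<in> UNIV \<rightarrow>\<^sub>E {- \<lceil>b\<rceil>..\<lceil>b\<rceil>}"
      by (auto simp: abs_le_iff minus_le_iff)
    moreover have "x = vec_lambda (\<lambda>i. x $ i)" by simp
    ultimately show ?thesis by blast
  qed
  then have "{x. vec_of_int x \<in> B} \<subseteq> vec_lambda ` (UNIV \<rightarrow>\<^sub>E {- \<lceil>b\<rceil>..\<lceil>b\<rceil>})"
    by blast
  moreover have "finite ((UNIV :: 'm set) \<rightarrow>\<^sub>E {- \<lceil>b\<rceil>..\<lceil>b\<rceil>})"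
    by (intro finite_PiE) auto
  ultimately show ?thesis by (meson finite_imageI finite_subset)
qed

lemma lookup_ehrhart_series:
  assumes "rational_polytope P"
  shows "Poly_Mapping.lookup (fps_nth (ehrhart_series P) k) x =
           (if (x, int k) \<in> ehrhart_monoid P then 1 else 0)"
proof -
  have "bounded ((\<lambda>p. of_int (int k) *\<^sub>R p) ` P)"
    using assms unfolding rational_polytope_def
    by (metis bounded_scaling finite_imp_bounded bounded_convex_hull)
  from finite_bounded_vec_of_int[OF this]
  have fin: "finite {y. (y, int k) \<in> ehrhart_monoid P}"
    by (simp add: ehrhart_monoid_def)
  have "Poly_Mapping.lookup (fps_nth (ehrhart_series P) k) x =
          (\<Sum>y | (y, int k) \<in> ehrhart_monoid P. if y = x then 1 else 0)"
    unfolding ehrhart_series_def fps_nth_Abs_fps lookup_sum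
    by (intro sum.cong refl) (simp add: lookup_single when_def)
  also have "\<dots> = (if (x, int k) \<in> ehrhart_monoid P then 1 else 0)"
    using fin by simp
  finally show ?thesis .
qed

text \<open>The affine monoid \<open>M\<close> is given as a subset of the real space containing its lattice.\<close>

definition gp :: "'a::real_vector set \<Rightarrow> 'a set" where
  "gp M = (\<lambda>G. 0 \<in> G \<and> (\<forall>a\<in>G. \<forall>b\<in>G. a - b \<in> G)) hull M"

text \<open>The hyperplanes \<open>H\<close> are those of the real span of \<open>gp M\<close>. The set is finite if \<open>M\<close> is an affine monoid
  and \<open>F\<close> a facet of its cone, so \<^const>\<open>card\<close> is then the actual number of such hyperplanes. As \<open>H\<close> is
  parallel to \<open>F\<close>, the last condition does not depend on the choice of \<open>y\<close>.\<close>

definition lattice_height :: "'a::euclidean_space set \<Rightarrow> 'a set \<Rightarrow> 'a \<Rightarrow> nat" where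
  "lattice_height M F x = card {H.
     affine H \<and> H \<subseteq> span (gp M) \<and> aff_dim H = aff_dim (span (gp M)) - 1 \<and>
     affine_parallel H (affine hull F) \<and> H \<inter> gp M \<noteq> {} \<and> \<not> F \<subseteq> H \<and>
     (\<forall>y\<in>F. H \<inter> closed_segment y x \<noteq> {})}"

definition height_le_1_over_all_facets :: "'a::euclidean_space set \<Rightarrow> 'a \<Rightarrow> bool" where
  "height_le_1_over_all_facets M x \<longleftrightarrow>
     (\<forall>F. F facet_of (convex_cone hull M) \<longrightarrow> lattice_height M F x \<le> 1)"

end

theory Submission
  imports Defs
begin

text \<open>
  Let \<open>C\<^sub>P\<close> be the cone over \<open>P \<times> {1}\<close>, so that the Ehrhart monoid of \<open>P\<close> consists of the lattice
  points of \<open>C\<^sub>P\<close>, and let \<open>e = (k p\<^sub>0, k)\<close>. Then \<open>C\<^sub>R = C\<^sub>P + C\<^sub>Q\<close>. The spans of \<open>C\<^sub>P\<close> and \<open>C\<^sub>Q\<close> meet in the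
  line \<open>\<real>e\<close>, the lattice points on this line are the integer multiples of \<open>e\<close> because \<open>k\<close> is minimal,
  and the hypothesis on the affine hulls says that every lattice point in the span of \<open>C\<^sub>R\<close> is a
  sum \<open>u + v\<close> of lattice points of the two spans. All other splittings of this point are
  \<open>(u + te) + (v - te)\<close>, with \<open>t\<close> an integer if the summands are to be lattice points.

  The right-hand side of the identity is always the series of the set \<open>\<E>(P) + \<E>(Q)\<close>:
  the factor \<open>1 - T\<^sup>e\<close> turns the series of \<open>\<E>(P)\<close> into the one of those \<open>a \<in> \<E>(P)\<close> with
  \<open>a - e \<notin> \<E>(P)\<close>, and every element of \<open>\<E>(P) + \<E>(Q)\<close> is in exactly one way such an \<open>a\<close> plus an element of
  \<open>\<E>(Q)\<close> (lemma \<open>set_series_sumset\<close>). So the identity says \<open>\<E>(R) = \<E>(P) + \<E>(Q)\<close>: whenever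
  \<open>u + te \<in> C\<^sub>P\<close> and \<open>v - te \<in> C\<^sub>Q\<close> for a real \<open>t\<close>, this happens for an integer \<open>t\<close> as well.

  A facet of \<open>C\<^sub>P\<close> is cut out by a linear form \<open>a\<close> that is nonnegative on \<open>C\<^sub>P\<close>, and the height of \<open>e\<close> over it is the
  number of values of \<open>a\<close> on the lattice that lie in the interval from \<open>0\<close> (excluded) to \<open>a(e)\<close>
  (lemma \<open>lattice_height_eq\<close>).

  If all these heights are at most 1, then \<open>a\<close> only takes integer multiples of \<open>a(e)\<close> on the lattice, unless
  \<open>a(e) = 0\<close>. Hence \<open>u + te \<in> C\<^sub>P\<close> implies \<open>u + \<lfloor>t\<rfloor>e \<in> C\<^sub>P\<close> (lemma \<open>height_le_1_imp_floor\<close>), while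
  \<open>v - \<lfloor>t\<rfloor>e\<close> stays in \<open>C\<^sub>Q\<close>, as it exceeds \<open>v - te\<close> by a nonnegative multiple of \<open>e\<close>. One of the polytopes is
  enough for this.

  If some height exceeds 1, then \<open>a\<close> takes a positive value of at most \<open>a(e)/2\<close> on the lattice, and the negative of
  this value is taken at a lattice point \<open>u \<notin> C\<^sub>P\<close> with \<open>u + e/2 \<in> C\<^sub>P\<close> (lemma \<open>height_gt_1_imp_half_gap\<close>). If this
  happens for \<open>P\<close> and for \<open>Q\<close>, with points \<open>u\<close> and \<open>v\<close>, then \<open>u + v + e\<close> lies in \<open>\<E>(R)\<close>. It is not in
  \<open>\<E>(P) + \<E>(Q)\<close>, since \<open>u + ne \<in> C\<^sub>P\<close> requires \<open>n \<ge> 1\<close> and \<open>v + (1 - n)e \<in> C\<^sub>Q\<close> requires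
  \<open>n \<le> 0\<close>.
\<close>

section \<open>Finitely generated convex cones\<close>

text \<open>The sum of the generators lies in the relative interior of the cone, so a large multiple of it
  makes all coefficients of a linear combination nonnegative.\<close>

lemma span_shift_into_cone:
  fixes W :: "'a::real_vector set"
  assumes "finite W" and "x \<in> span W"
  shows "\<exists>N::nat. x + real N *\<^sub>R \<Sum>W \<in> convex_cone hull W"
proof -
  obtain c where c: "x = (\<Sum>w\<in>W. c w *\<^sub>R w)"
    using assms by (auto simp: span_finite)
  obtain N :: nat where N: "(\<Sum>w\<in>W. \<bar>c w\<bar>) \<le> real N"
    using real_arch_simple by blast
  have le: "\<bar>c w\<bar> \<le> real N" if "w \<in> W" for w
    using N member_le_sum[of w W "\<lambda>w. \<bar>c w\<bar>"] that assms(1) by force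
  have "x + real N *\<^sub>R \<Sum>W = (\<Sum>w\<in>W. (c w + real N) *\<^sub>R w)"
    by (simp add: c scaleR_left_distrib sum.distrib scaleR_right.sum)
  also have "\<dots> \<in> convex_cone hull W"
  proof -
    have "(\<Sum>w\<in>A. (c w + real N) *\<^sub>R w) \<in> convex_cone hull W" if "A \<subseteq> W" for A
      using finite_subset[OF that assms(1)] that
    proof (induction A)
      case empty
      show ?case by (simp add: convex_cone_hull_contains_0)
    next
      case (insert w A)
      have "(c w + real N) *\<^sub>R w \<in> convex_cone hull W"
        using insert.prems le[of w] by (intro convex_cone_hull_mul hull_inc) auto
      then show ?case using insert by (simp add: convex_cone_hull_add)
    qed
    then show ?thesis by blast
  qed
  finally show ?thesis by blast
qed

lemma gp_diff: "x \<in> gp M \<Longrightarrow> y \<in> gp M \<Longrightarrow> x - y \<in> gp M"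
  unfolding gp_def hull_def by simp

lemma span_convex_cone_hull: "span (convex_cone hull W) = span W"
proof
  have "convex_cone hull W \<subseteq> span W"
    by (simp add: convex_cone_span hull_minimal span_superset)
  then show "span (convex_cone hull W) \<subseteq> span W"
    by (simp add: span_minimal)
  show "span W \<subseteq> span (convex_cone hull W)"
    by (simp add: hull_subset span_mono)
qed

lemma convex_cone_hull_nonneg:
  assumes "\<And>v. v \<in> W \<Longrightarrow> 0 \<le> a \<bullet> v" and "x \<in> convex_cone hull W"
  shows "0 \<le> a \<bullet> x"
proof -
  have "convex_cone hull W \<subseteq> {x. a \<bullet> x \<ge> 0}"
    by (rule hull_minimal) (auto simp: assms convex_cone_halfspace_ge)
  with assms(2) show ?thesis by blast
qed

text \<open>A nonnegative combination with value zero only involves generators of value zero.\<close>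

lemma convex_cone_hull_Int_hyperplane:
  assumes "finite V" and nn: "\<And>v. v \<in> V \<Longrightarrow> 0 \<le> a \<bullet> v"
  shows "convex_cone hull V \<inter> {x. a \<bullet> x = 0} = convex_cone hull {v\<in>V. a \<bullet> v = 0}"
proof -
  define V0 where "V0 = {v\<in>V. a \<bullet> v = 0}"
  define V1 where "V1 = {v\<in>V. a \<bullet> v > 0}"
  have V: "V = V0 \<union> V1"
    using nn by (force simp: V0_def V1_def)
  let ?T = "insert 0 {x. a \<bullet> x > 0}"
  have "convex_cone ?T"
    by (auto simp: convex_cone_iff inner_right_distrib le_less)
  then have V1: "convex_cone hull V1 \<subseteq> ?T"
    by (intro hull_minimal) (auto simp: V1_def)
  have "subspace {x. a \<bullet> x = 0}"
    by (simp add: subspace_hyperplane)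
  then have V0: "convex_cone hull V0 \<subseteq> {x. a \<bullet> x = 0}"
    by (intro hull_minimal subspace_imp_convex_cone) (auto simp: V0_def)
  have "x \<in> convex_cone hull V0" if x: "x \<in> convex_cone hull V" "a \<bullet> x = 0" for x
  proof -
    obtain y z where yz: "x = y + z" "y \<in> convex_cone hull V0" "z \<in> convex_cone hull V1"
      using x(1) unfolding V convex_cone_hull_Un by auto
    then have "a \<bullet> z = 0" using V0 x(2) by (auto simp: inner_right_distrib)
    then have "z = 0" using V1 yz(3) by auto
    then show ?thesis using yz by simp
  qed
  moreover have "convex_cone hull V0 \<subseteq> convex_cone hull V"
    by (rule hull_mono) (auto simp: V0_def)
  ultimately show ?thesis using V0 unfolding V0_def[symmetric] by blast
qed

section \<open>Lattice points of rational cones and heights over facets\<close>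

text \<open>Discreteness enters as finiteness in bounded sets, so that no basis of the lattice has to be
  chosen. Its rank may exceed the dimension of the cone, whose lattice points generate
  the group \<^term>\<open>span V \<inter> \<Lambda>\<close>. Generators in the lattice make the cone rational.\<close>

locale lattice_cone =
  fixes \<Lambda> V :: "'a::euclidean_space set"
  assumes lattice_zero: "0 \<in> \<Lambda>"
    and lattice_diff: "x \<in> \<Lambda> \<Longrightarrow> y \<in> \<Lambda> \<Longrightarrow> x - y \<in> \<Lambda>"
    and lattice_finite_Int: "bounded B \<Longrightarrow> finite (\<Lambda> \<inter> B)"
    and finite_generators: "finite V"
    and generators_in_lattice: "V \<subseteq> \<Lambda>"
begin

abbreviation C :: "'a set" where "C \<equiv> convex_cone hull V"

abbreviation L :: "'a set" where "L \<equiv> span V"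

lemma lattice_add: "x \<in> \<Lambda> \<Longrightarrow> y \<in> \<Lambda> \<Longrightarrow> x + y \<in> \<Lambda>"
  using lattice_diff[of x "- y"] lattice_diff[of 0 y] lattice_zero by simp

lemma lattice_of_nat: "x \<in> \<Lambda> \<Longrightarrow> real n *\<^sub>R x \<in> \<Lambda>"
  by (induction n) (simp_all add: lattice_zero lattice_add scaleR_left_distrib)

lemma lattice_of_int:
  assumes "x \<in> \<Lambda>"
  shows "of_int n *\<^sub>R x \<in> \<Lambda>"
proof (cases n rule: int_cases2)
  case (nonneg j)
  then show ?thesis using lattice_of_nat[OF assms] by simp
next
  case (nonpos j)
  then show ?thesis using lattice_diff[OF lattice_zero lattice_of_nat[OF assms], of j] by simp
qed

lemma lattice_sum: "(\<And>i. i \<in> I \<Longrightarrow> f i \<in> \<Lambda>) \<Longrightarrow> sum f I \<in> \<Lambda>"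
  by (induction I rule: infinite_finite_induct) (auto simp: lattice_zero lattice_add)

lemma cone_subset_span: "C \<subseteq> L"
  using span_superset[of "convex_cone hull V"] by (simp add: span_convex_cone_hull)

lemma convex_cone_hull_lattice_points: "convex_cone hull (C \<inter> \<Lambda>) = C"
proof
  show "convex_cone hull (C \<inter> \<Lambda>) \<subseteq> C"
    by (intro hull_minimal) (auto simp: convex_cone_convex_cone_hull)
  show "C \<subseteq> convex_cone hull (C \<inter> \<Lambda>)"
    using generators_in_lattice by (intro hull_mono) (auto simp: hull_inc)
qed

text \<open>A lattice point \<open>x\<close> of the span is the difference of \<open>x + w\<close> and \<open>w\<close>, where \<open>w\<close> is a lattice point so deep
  in the cone that \<open>x + w\<close> also lies in the cone.\<close>

lemma gp_lattice_points: "gp (C \<inter> \<Lambda>) = L \<inter> \<Lambda>"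
proof
  show "gp (C \<inter> \<Lambda>) \<subseteq> L \<inter> \<Lambda>"
    unfolding gp_def using cone_subset_span
    by (intro hull_minimal) (auto simp: lattice_zero lattice_diff span_zero span_diff)
  show "L \<inter> \<Lambda> \<subseteq> gp (C \<inter> \<Lambda>)"
  proof
    fix x assume x: "x \<in> L \<inter> \<Lambda>"
    then obtain N :: nat where N: "x + real N *\<^sub>R \<Sum>V \<in> C"
      using span_shift_into_cone[OF finite_generators] by blast
    have w: "real N *\<^sub>R \<Sum>V \<in> C \<inter> \<Lambda>"
    proof
      show "real N *\<^sub>R \<Sum>V \<in> C"
      proof (rule convex_cone_hull_mul)
        have "\<Sum>A \<in> C" if "A \<subseteq> V" for A
          using finite_subset[OF that finite_generators] that
          by (induction A) (auto simp: convex_cone_hull_contains_0 convex_cone_hull_add hull_inc)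
        then show "\<Sum>V \<in> C" by blast
      qed simp
      show "real N *\<^sub>R \<Sum>V \<in> \<Lambda>"
        using generators_in_lattice by (intro lattice_of_nat lattice_sum) auto
    qed
    have "x + real N *\<^sub>R \<Sum>V \<in> C \<inter> \<Lambda>"
      using N w x by (simp add: lattice_add)
    with w have "(x + real N *\<^sub>R \<Sum>V) - real N *\<^sub>R \<Sum>V \<in> gp (C \<inter> \<Lambda>)"
      by (intro gp_diff) (simp_all add: gp_def hull_inc)
    then show "x \<in> gp (C \<inter> \<Lambda>)" by simp
  qed
qed

lemma span_gp_lattice_points: "span (gp (C \<inter> \<Lambda>)) = L"
  unfolding gp_lattice_points
proof (rule span_subspace)
  show "L \<subseteq> span (L \<inter> \<Lambda>)"
    using generators_in_lattice by (intro span_mono) (auto simp: span_base)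
qed auto

text \<open>The form \<^term>\<open>a\<close> is neither normalised nor determined by the facet: positive multiples
  and changes orthogonal to the span of the cone do not matter for the number of values that it takes.\<close>

definition supports_facet :: "'a \<Rightarrow> 'a set \<Rightarrow> bool" where
  "supports_facet a F \<longleftrightarrow>
     F facet_of C \<and> (\<forall>v\<in>V. 0 \<le> a \<bullet> v) \<and> F = C \<inter> {x. a \<bullet> x = 0}"

lemma cone_nonneg: "supports_facet a F \<Longrightarrow> x \<in> C \<Longrightarrow> 0 \<le> a \<bullet> x"
  unfolding supports_facet_def by (meson convex_cone_hull_nonneg)

lemma supporting_hyperplane_through_0:
  assumes "C \<subseteq> {x. a \<bullet> x \<le> b}" and "C \<inter> {x. a \<bullet> x = b} facet_of C"
  shows "b = 0" and "supports_facet (- a) (C \<inter> {x. a \<bullet> x = b})"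
proof -
  have "C \<inter> {x. a \<bullet> x = b} \<noteq> {}"
    using assms(2) by (auto simp: facet_of_def)
  then obtain y where y: "y \<in> C" "a \<bullet> y = b" by blast
  then have "2 *\<^sub>R y \<in> C" by (intro convex_cone_hull_mul) auto
  then have "a \<bullet> (2 *\<^sub>R y) \<le> b" using assms(1) by blast
  with y(2) have "b \<le> 0" by simp
  moreover have "a \<bullet> 0 \<le> b" using assms(1) convex_cone_hull_contains_0 by blast
  ultimately show b: "b = 0" by simp
  have "a \<bullet> v \<le> 0" if "v \<in> V" for v
  proof -
    have "v \<in> C" using that by (rule hull_inc)
    then show ?thesis using assms(1) b by blast
  qed
  then show "supports_facet (- a) (C \<inter> {x. a \<bullet> x = b})"
    using assms(2) b unfolding supports_facet_def by simp
qed

lemma facet_has_support: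
  assumes "F facet_of C"
  obtains a where "supports_facet a F"
proof -
  obtain a b where "C \<subseteq> {x. a \<bullet> x \<le> b}" "F = C \<inter> {x. a \<bullet> x = b}"
    using facet_of_polyhedron[OF polyhedron_convex_cone_hull[OF finite_generators] assms] by metis
  then show thesis
    using supporting_hyperplane_through_0(2)[of a b] assms that by blast
qed

lemma affine_hull_cone: "affine hull C = L"
proof -
  have "0 \<in> affine hull C" by (simp add: convex_cone_hull_contains_0 hull_inc)
  from affine_hull_span_0[OF this] show ?thesis by (simp add: span_convex_cone_hull)
qed

text \<open>A polyhedron is cut out of its affine hull by finitely many halfspaces of which none can be omitted,
  and each of these defines a facet.\<close>

lemma in_cone_if_facets:
  assumes "x \<in> L" and "\<And>a F. supports_facet a F \<Longrightarrow> 0 \<le> a \<bullet> x"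
  shows "x \<in> C"
proof -
  have "polyhedron C"
    by (rule polyhedron_convex_cone_hull[OF finite_generators])
  then obtain H where H: "finite H" "C = affine hull C \<inter> \<Inter>H"
    "\<forall>h\<in>H. \<exists>a b. a \<noteq> 0 \<and> h = {x. a \<bullet> x \<le> b}"
    "\<And>H'. H' \<subset> H \<Longrightarrow> C \<subset> affine hull C \<inter> \<Inter>H'"
    unfolding polyhedron_Int_affine_minimal by auto
  then obtain a b where ab: "\<And>h. h \<in> H \<Longrightarrow> a h \<noteq> 0 \<and> h = {x. a h \<bullet> x \<le> b h}"
    by metis
  have "x \<in> h" if h: "h \<in> H" for h
  proof -
    have "C \<subseteq> h" using H(2) h by blast
    then have sub: "C \<subseteq> {x. a h \<bullet> x \<le> b h}" using ab[OF h] by blast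
    have fac: "C \<inter> {x. a h \<bullet> x = b h} facet_of C"
      using facet_of_polyhedron_explicit[OF H(1,2) ab H(4), of "C \<inter> {x. a h \<bullet> x = b h}"] h by blast
    have "0 \<le> - a h \<bullet> x"
      using supporting_hyperplane_through_0(2)[OF sub fac] assms(2) by blast
    then have "a h \<bullet> x \<le> b h"
      using supporting_hyperplane_through_0(1)[OF sub fac] by simp
    then show ?thesis using ab[OF h] by blast
  qed
  then show ?thesis using H(2) assms(1) affine_hull_cone by blast
qed

text \<open>The generators on a facet span the whole hyperplane that the form cuts out, since the facet has
  codimension 1. Up to a factor, this makes the form rational on the span of the cone.\<close>

lemma facet_span:
  assumes "supports_facet a F"
  shows "span {v\<in>V. a \<bullet> v = 0} = L \<inter> {x. a \<bullet> x = 0}" (is "?S = ?K")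
    and "affine hull F = L \<inter> {x. a \<bullet> x = 0}"
    and "aff_dim (L \<inter> {x. a \<bullet> x = 0}) = aff_dim L - 1"
    and "\<exists>v\<in>V. 0 < a \<bullet> v"
proof -
  have fac: "F facet_of C" and nn: "\<And>v. v \<in> V \<Longrightarrow> 0 \<le> a \<bullet> v" and F: "F = C \<inter> {x. a \<bullet> x = 0}"
    using assms by (auto simp: supports_facet_def)
  have Fhull: "F = convex_cone hull {v\<in>V. a \<bullet> v = 0}"
    unfolding F by (rule convex_cone_hull_Int_hyperplane[OF finite_generators nn])
  have "0 \<in> affine hull F"
    unfolding Fhull by (simp add: convex_cone_hull_contains_0 hull_inc)
  from affine_hull_span_0[OF this] have aF: "affine hull F = ?S"
    unfolding Fhull span_convex_cone_hull .
  have "aff_dim F = aff_dim C - 1"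
    using fac by (simp add: facet_of_def)
  then have dim: "aff_dim ?S = aff_dim L - 1"
    by (metis aF aff_dim_affine_hull affine_hull_cone)
  show pos: "\<exists>v\<in>V. 0 < a \<bullet> v"
  proof (rule ccontr)
    assume "\<not> ?thesis"
    then have "{v\<in>V. a \<bullet> v = 0} = V" using nn by (auto simp: not_less order_antisym)
    with dim show False by simp
  qed
  have subK: "subspace ?K" by (simp add: subspace_inter subspace_hyperplane)
  then have sub: "?S \<subseteq> ?K"
    by (rule span_minimal[rotated]) (auto simp: span_base)
  obtain v where "v \<in> V" "0 < a \<bullet> v" using pos by blast
  then have "v \<in> L - ?K" by (simp add: span_base)
  then have "?K \<subset> L" by blast
  moreover have "span ?K = ?K" using subK by simp
  ultimately have "span ?K \<subset> span L" by (simp only: span_span)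
  then have "dim ?K < dim L" by (rule dim_psubset)
  moreover have "int (dim ?S) = int (dim L) - 1"
    using dim by (simp add: aff_dim_subspace)
  ultimately have "dim ?K \<le> dim ?S" by linarith
  then show eq: "?S = ?K"
    using sub subK by (intro subspace_dim_equal) simp_all
  show "affine hull F = ?K" using aF eq by simp
  show "aff_dim ?K = aff_dim L - 1" using dim eq by simp
qed

definition facet_values :: "'a \<Rightarrow> real \<Rightarrow> real set" where
  "facet_values a b = {a \<bullet> x |x. x \<in> L \<inter> \<Lambda> \<and> 0 < a \<bullet> x \<and> a \<bullet> x \<le> b}"

text \<open>The generators on the facet are lattice points. Subtracting integer multiples of them changes no value of
  the form and moves a lattice point of bounded value into a bounded set, which contains only
  finitely many lattice points.\<close>

lemma finite_facet_values:
  assumes "supports_facet a F"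
  shows "finite (facet_values a b)"
proof -
  let ?W = "{v\<in>V. a \<bullet> v = 0}"
  obtain v where v: "v \<in> V" "0 < a \<bullet> v" using facet_span(4)[OF assms] by blast
  define r where "r = b / (a \<bullet> v) * norm v + (\<Sum>w\<in>?W. norm w)"
  have "facet_values a b \<subseteq> (\<lambda>x. a \<bullet> x) ` (\<Lambda> \<inter> cball 0 r)"
  proof
    fix c assume "c \<in> facet_values a b"
    then obtain x where x: "x \<in> L" "x \<in> \<Lambda>" "0 < a \<bullet> x" "a \<bullet> x \<le> b" and c: "c = a \<bullet> x"
      by (auto simp: facet_values_def)
    let ?y = "x - (a \<bullet> x / (a \<bullet> v)) *\<^sub>R v"
    have "?y \<in> L \<inter> {x. a \<bullet> x = 0}"
      using x(1) v by (auto simp: inner_diff_right span_diff span_mul span_base)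
    then have "?y \<in> span ?W" using facet_span(1)[OF assms] by simp
    then obtain d where d: "?y = (\<Sum>w\<in>?W. d w *\<^sub>R w)"
      using finite_generators by (auto simp: span_finite)
    define z where "z = x - (\<Sum>w\<in>?W. of_int \<lfloor>d w\<rfloor> *\<^sub>R w)"
    have "z \<in> \<Lambda>"
      unfolding z_def using x(2) generators_in_lattice
      by (intro lattice_diff lattice_sum lattice_of_int) auto
    moreover have "a \<bullet> z = c"
      by (simp add: z_def c inner_diff_right inner_sum_right)
    moreover have "norm z \<le> r"
    proof -
      have "z = (a \<bullet> x / (a \<bullet> v)) *\<^sub>R v + (\<Sum>w\<in>?W. frac (d w) *\<^sub>R w)"
        using d by (simp add: z_def frac_def scaleR_left_diff_distrib sum_subtractf algebra_simps)
      also have "norm \<dots> \<le> norm ((a \<bullet> x / (a \<bullet> v)) *\<^sub>R v) + (\<Sum>w\<in>?W. norm (frac (d w) *\<^sub>R w))"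
        by (intro norm_triangle_mono order_refl norm_sum)
      also have "\<dots> \<le> r"
        unfolding r_def
      proof (intro add_mono sum_mono)
        show "norm ((a \<bullet> x / (a \<bullet> v)) *\<^sub>R v) \<le> b / (a \<bullet> v) * norm v"
          using x v by (auto intro!: mult_right_mono divide_right_mono)
        show "norm (frac (d w) *\<^sub>R w) \<le> norm w" for w
          using frac_lt_1[of "d w"] by (simp add: mult_left_le_one_le)
      qed
      finally show ?thesis .
    qed
    ultimately show "c \<in> (\<lambda>x. a \<bullet> x) ` (\<Lambda> \<inter> cball 0 r)" by force
  qed
  then show ?thesis
    using lattice_finite_Int[of "cball 0 r"] by (meson bounded_cball finite_imageI finite_subset)
qed

text \<open>The hyperplanes that are counted are the level sets of the form through lattice points. The one at
  level \<open>c\<close> meets the segment from a point of the facet to \<open>e\<close> if and only if \<open>c\<close> lies between \<open>0\<close> and the value at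
  \<open>e\<close>; the level \<open>0\<close> is the hyperplane that contains the facet.\<close>

lemma lattice_height_eq:
  assumes a: "supports_facet a F" and e: "e \<in> C"
  shows "lattice_height (C \<inter> \<Lambda>) F e = card (facet_values a (a \<bullet> e))"
proof -
  let ?K = "L \<inter> {x. a \<bullet> x = 0}"
  let ?H = "\<lambda>c. {x\<in>L. a \<bullet> x = c}"
  have F: "F \<subseteq> ?K" "0 \<in> F"
    using a cone_subset_span by (auto simp: supports_facet_def convex_cone_hull_contains_0)
  have translate: "?H (a \<bullet> y) = (\<lambda>x. y + x) ` ?K" if "y \<in> L" for y
  proof
    show "?H (a \<bullet> y) \<subseteq> (\<lambda>x. y + x) ` ?K"
    proof
      fix x assume "x \<in> ?H (a \<bullet> y)"
      then have "x - y \<in> ?K" using that by (auto simp: span_diff inner_diff_right)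
      then show "x \<in> (\<lambda>x. y + x) ` ?K" by force
    qed
  qed (use that in \<open>auto simp: span_add inner_add_right\<close>)
  have subK: "subspace ?K" by (simp add: subspace_inter subspace_hyperplane)
  have "{H. affine H \<and> H \<subseteq> L \<and> aff_dim H = aff_dim L - 1 \<and> affine_parallel H ?K \<and>
            H \<inter> (L \<inter> \<Lambda>) \<noteq> {} \<and> \<not> F \<subseteq> H \<and> (\<forall>y\<in>F. H \<inter> closed_segment y e \<noteq> {})} =
        ?H ` facet_values a (a \<bullet> e)" (is "?lhs = ?rhs")
  proof
    show "?lhs \<subseteq> ?rhs"
    proof
      fix H assume "H \<in> ?lhs"
      then have HL: "H \<subseteq> L" and par: "affine_parallel H ?K" and nF: "\<not> F \<subseteq> H"
        and seg: "\<And>y. y \<in> F \<Longrightarrow> H \<inter> closed_segment y e \<noteq> {}"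
        and "H \<inter> (L \<inter> \<Lambda>) \<noteq> {}" by auto
      then obtain y where y: "y \<in> H" "y \<in> L" "y \<in> \<Lambda>" by blast
      obtain d where d: "?K = (\<lambda>x. d + x) ` H"
        using par by (auto simp: affine_parallel_def)
      have "x \<in> H \<longleftrightarrow> x \<in> ?H (a \<bullet> y)" for x
      proof -
        have iff: "x \<in> H \<longleftrightarrow> d + x \<in> ?K" for x unfolding d by force
        have dy: "d + y \<in> ?K" using y(1) iff by blast
        have "d + x \<in> ?K \<longleftrightarrow> x - y \<in> ?K"
        proof
          assume "d + x \<in> ?K"
          from subspace_diff[OF subK this dy] show "x - y \<in> ?K" by simp
        next
          assume "x - y \<in> ?K"
          from subspace_add[OF subK this dy] show "d + x \<in> ?K" by (simp add: algebra_simps)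
        qed
        also have "\<dots> \<longleftrightarrow> x \<in> ?H (a \<bullet> y)"
          using y(2) span_add[of "x - y" V y] span_diff[of x V y] by (auto simp: inner_diff_right)
        finally show ?thesis using iff by blast
      qed
      then have H: "H = ?H (a \<bullet> y)" by blast
      have "a \<bullet> y \<noteq> 0" using F(1) nF H by auto
      moreover obtain s where "0 \<le> s" "s \<le> 1" "s *\<^sub>R e \<in> H"
        using seg[OF F(2)] by (auto simp: closed_segment_def)
      then have "0 \<le> s" "s \<le> 1" "a \<bullet> y = s * (a \<bullet> e)" using H by auto
      then have "0 \<le> a \<bullet> y \<and> a \<bullet> y \<le> a \<bullet> e"
        using cone_nonneg[OF a e] by (simp add: mult_left_le_one_le)
      ultimately have "a \<bullet> y \<in> facet_values a (a \<bullet> e)"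
        unfolding facet_values_def using y by fastforce
      then show "H \<in> ?rhs" using H by blast
    qed
    show "?rhs \<subseteq> ?lhs"
    proof
      fix H assume "H \<in> ?rhs"
      then obtain y where y: "y \<in> L" "y \<in> \<Lambda>" "0 < a \<bullet> y" "a \<bullet> y \<le> a \<bullet> e"
        and H: "H = ?H (a \<bullet> y)"
        by (auto simp: facet_values_def)
      have HK: "H = (\<lambda>x. y + x) ` ?K" using translate[OF y(1)] H by simp
      have "affine H"
        unfolding HK using subspace_imp_affine[OF subK] affine_translation by blast
      moreover have "aff_dim H = aff_dim L - 1"
        unfolding HK aff_dim_translation_eq by (rule facet_span(3)[OF a])
      moreover have "affine_parallel ?K H"
        unfolding HK affine_parallel_def by blast
      then have "affine_parallel H ?K" using affine_parallel_commute by blast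
      moreover have "\<not> F \<subseteq> H" using F(2) H y(3) by auto
      moreover have "H \<inter> closed_segment x e \<noteq> {}" if x: "x \<in> F" for x
      proof -
        let ?s = "a \<bullet> y / (a \<bullet> e)"
        have s: "0 \<le> ?s" "?s \<le> 1" using y(3,4) by (auto simp: divide_simps)
        have "a \<bullet> x = 0" "x \<in> L" using x F(1) by auto
        moreover have "e \<in> L" using e cone_subset_span by blast
        ultimately have "(1 - ?s) *\<^sub>R x + ?s *\<^sub>R e \<in> H"
          using y(3,4) unfolding H by (simp add: inner_add_right span_add span_mul)
        moreover have "(1 - ?s) *\<^sub>R x + ?s *\<^sub>R e \<in> closed_segment x e"
          using s unfolding closed_segment_def by blast
        ultimately show ?thesis by blast
      qed
      ultimately show "H \<in> ?lhs" using y(1,2) H by blast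
    qed
  qed
  moreover have "inj_on ?H (facet_values a (a \<bullet> e))"
    by (auto simp: inj_on_def facet_values_def)
  ultimately show ?thesis
    unfolding lattice_height_def gp_lattice_points span_gp_lattice_points[unfolded gp_lattice_points]
      facet_span(2)[OF a]
    by (simp only: card_image)
qed

text \<open>Otherwise the remainder of division by the value at \<open>e\<close> would be a second value in the interval
  that determines the height.\<close>

lemma facet_value_multiple:
  assumes a: "supports_facet a F" and e: "e \<in> C \<inter> \<Lambda>" "0 < a \<bullet> e" and u: "u \<in> L \<inter> \<Lambda>"
    and height: "lattice_height (C \<inter> \<Lambda>) F e \<le> 1"
  shows "\<exists>m::int. a \<bullet> u = of_int m * (a \<bullet> e)"
proof -
  let ?b = "a \<bullet> e"
  define m where "m = \<lfloor>a \<bullet> u / ?b\<rfloor>"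
  let ?x = "u - of_int m *\<^sub>R e"
  have eL: "e \<in> L" using e cone_subset_span by blast
  have "of_int m \<le> a \<bullet> u / ?b" "a \<bullet> u / ?b < of_int m + 1"
    unfolding m_def by linarith+
  then have m: "of_int m * ?b \<le> a \<bullet> u" "a \<bullet> u < (of_int m + 1) * ?b"
    using e(2) by (simp_all add: pos_le_divide_eq pos_divide_less_eq)
  then have x: "0 \<le> a \<bullet> ?x" "a \<bullet> ?x < ?b"
    by (simp_all add: inner_diff_right algebra_simps)
  have "a \<bullet> ?x = 0"
  proof (rule ccontr)
    assume "a \<bullet> ?x \<noteq> 0"
    moreover have "?x \<in> L \<inter> \<Lambda>"
      using u e eL by (auto intro: span_diff span_mul lattice_diff lattice_of_int)
    ultimately have "a \<bullet> ?x \<in> facet_values a ?b"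
      using x unfolding facet_values_def by force
    moreover have "?b \<in> facet_values a ?b"
      using e eL unfolding facet_values_def by blast
    ultimately have "card {a \<bullet> ?x, ?b} \<le> card (facet_values a ?b)"
      using finite_facet_values[OF a] by (intro card_mono) auto
    with height lattice_height_eq[OF a, of e] e x(2) show False by simp
  qed
  then show ?thesis by (auto simp: inner_diff_right)
qed

text \<open>For each facet form \<open>a\<close> the condition on \<open>t\<close> is \<open>m + t \<ge> 0\<close> with the integer \<open>m = a(u)/a(e)\<close>, and it
  survives rounding down; if \<open>a(e) = 0\<close>, it does not depend on \<open>t\<close>.\<close>

lemma height_le_1_imp_floor:
  assumes height: "height_le_1_over_all_facets (C \<inter> \<Lambda>) e" and e: "e \<in> C \<inter> \<Lambda>"
    and u: "u \<in> L \<inter> \<Lambda>" and t: "u + t *\<^sub>R e \<in> C"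
  shows "u + of_int \<lfloor>t\<rfloor> *\<^sub>R e \<in> C"
proof (rule in_cone_if_facets)
  show "u + of_int \<lfloor>t\<rfloor> *\<^sub>R e \<in> L"
    using u e cone_subset_span by (auto intro: span_add span_mul)
  fix a F assume a: "supports_facet a F"
  have h: "lattice_height (C \<inter> \<Lambda>) F e \<le> 1"
    using height a
    unfolding height_le_1_over_all_facets_def convex_cone_hull_lattice_points supports_facet_def
    by blast
  have nn: "0 \<le> a \<bullet> u + t * (a \<bullet> e)"
    using cone_nonneg[OF a t] by (simp add: inner_add_right)
  have "0 \<le> a \<bullet> e" using cone_nonneg[OF a] e by blast
  then consider "a \<bullet> e = 0" | "0 < a \<bullet> e" by linarith
  then show "0 \<le> a \<bullet> (u + of_int \<lfloor>t\<rfloor> *\<^sub>R e)"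
  proof cases
    case 1
    with nn show ?thesis by (simp add: inner_add_right)
  next
    case 2
    then obtain m :: int where m: "a \<bullet> u = of_int m * (a \<bullet> e)"
      using facet_value_multiple[OF a e _ u h] by blast
    then have "0 \<le> (of_int m + t) * (a \<bullet> e)" using nn by (simp add: algebra_simps)
    then have "0 \<le> of_int m + t" using 2 by (simp add: zero_le_mult_iff)
    then have "0 \<le> m + \<lfloor>t\<rfloor>" by linarith
    then have "0 \<le> real_of_int (m + \<lfloor>t\<rfloor>) * (a \<bullet> e)" using 2 by simp
    then show ?thesis by (simp add: inner_add_right m algebra_simps)
  qed
qed

text \<open>Only the inequality of one facet has to hold beforehand: adding a large multiple of a lattice
  point in the relative interior of this facet enforces all the others and preserves this one.\<close>

lemma shift_along_facet:
  assumes a: "supports_facet a F" and x: "x \<in> L" "0 \<le> a \<bullet> x"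
  obtains w where "w \<in> L \<inter> \<Lambda>" "a \<bullet> w = 0" "x + w \<in> C"
proof -
  let ?W = "{v\<in>V. a \<bullet> v = 0}"
  obtain v where v: "v \<in> V" "0 < a \<bullet> v" using facet_span(4)[OF a] by blast
  let ?c = "a \<bullet> x / (a \<bullet> v)"
  have "x - ?c *\<^sub>R v \<in> L \<inter> {x. a \<bullet> x = 0}"
    using x v by (auto simp: inner_diff_right span_diff span_mul span_base)
  then have "x - ?c *\<^sub>R v \<in> span ?W" using facet_span(1)[OF a] by simp
  then obtain N :: nat where N: "x - ?c *\<^sub>R v + real N *\<^sub>R \<Sum>?W \<in> convex_cone hull ?W"
    using span_shift_into_cone[of ?W] finite_generators by auto
  show thesis
  proof
    show "real N *\<^sub>R \<Sum>?W \<in> L \<inter> \<Lambda>"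
    proof
      show "real N *\<^sub>R \<Sum>?W \<in> L" by (intro span_mul span_sum) (auto simp: span_base)
      show "real N *\<^sub>R \<Sum>?W \<in> \<Lambda>"
        using generators_in_lattice by (intro lattice_of_nat lattice_sum) auto
    qed
    show "a \<bullet> (real N *\<^sub>R \<Sum>?W) = 0" by (simp add: inner_sum_right)
    have "convex_cone hull ?W \<subseteq> C" by (rule hull_mono) auto
    then have "x - ?c *\<^sub>R v + real N *\<^sub>R \<Sum>?W \<in> C" using N by blast
    moreover have "?c *\<^sub>R v \<in> C"
      using x v by (intro convex_cone_hull_mul hull_inc) auto
    ultimately have "(x - ?c *\<^sub>R v + real N *\<^sub>R \<Sum>?W) + ?c *\<^sub>R v \<in> C"
      by (rule convex_cone_hull_add)
    then show "x + real N *\<^sub>R \<Sum>?W \<in> C" by (simp add: algebra_simps)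
  qed
qed

text \<open>Two lattice values \<open>c < d\<close> in the interval up to \<open>a(e)\<close> give a positive value of at most \<open>a(e)/2\<close>, namely
  \<open>c\<close> or \<open>d - c\<close>.\<close>

lemma height_gt_1_imp_half_gap:
  assumes height: "\<not> height_le_1_over_all_facets (C \<inter> \<Lambda>) e" and e: "e \<in> C \<inter> \<Lambda>"
  obtains u where "u \<in> L \<inter> \<Lambda>" "u + (1/2) *\<^sub>R e \<in> C" "u \<notin> C"
proof -
  obtain F where F: "F facet_of C" "\<not> lattice_height (C \<inter> \<Lambda>) F e \<le> 1"
    using height by (auto simp: height_le_1_over_all_facets_def convex_cone_hull_lattice_points)
  obtain a where a: "supports_facet a F" using facet_has_support[OF F(1)] .
  let ?A = "facet_values a (a \<bullet> e)"
  have "1 < card ?A" using F(2) lattice_height_eq[OF a, of e] e by simp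
  then obtain c d where "c \<in> ?A" "d \<in> ?A" "c < d"
    by (metis card_le_Suc0_iff_eq finite_facet_values[OF a] leD less_linear not_le One_nat_def)
  then obtain x y where xy: "x \<in> L \<inter> \<Lambda>" "y \<in> L \<inter> \<Lambda>" "0 < a \<bullet> x" "a \<bullet> x < a \<bullet> y" "a \<bullet> y \<le> a \<bullet> e"
    by (auto simp: facet_values_def)
  obtain z where z: "z \<in> L \<inter> \<Lambda>" "0 < a \<bullet> z" "a \<bullet> z \<le> (a \<bullet> e) / 2"
  proof (cases "a \<bullet> x \<le> (a \<bullet> e) / 2")
    case True
    with xy show thesis by (intro that[of x])
  next
    case False
    with xy show thesis
      by (intro that[of "y - x"]) (auto simp: span_diff lattice_diff inner_diff_right)
  qed
  \<comment> \<open>The value at \<open>-z\<close> is negative and becomes nonnegative after half a step along \<open>e\<close>;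
    the other facets are taken care of by a shift \<open>w\<close> along the chosen one.\<close>
  let ?x = "- z + (1/2) *\<^sub>R e"
  have eL: "e \<in> L" using e cone_subset_span by blast
  have "?x \<in> L" using z(1) eL by (intro span_add span_mul span_neg) auto
  moreover have "0 \<le> a \<bullet> ?x" using z(3) by (simp add: inner_add_right inner_diff_right)
  ultimately obtain w where w: "w \<in> L \<inter> \<Lambda>" "a \<bullet> w = 0" "?x + w \<in> C"
    by (rule shift_along_facet[OF a])
  show thesis
  proof
    show "w - z \<in> L \<inter> \<Lambda>" using w z by (auto simp: span_diff lattice_diff)
    show "w - z + (1/2) *\<^sub>R e \<in> C" using w(3) by (simp add: algebra_simps)
    have "a \<bullet> (w - z) < 0" using w(2) z(2) by (simp add: inner_diff_right)
    then show "w - z \<notin> C" using cone_nonneg[OF a] by fastforce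
  qed
qed

end

section \<open>Cones whose spans share a line\<close>

text \<open>A real splitting \<open>c + d\<close> and an integral one \<open>u + v\<close> of the same point differ by a multiple \<open>te\<close>, because
  the difference lies in both spans. Rounding \<open>t\<close> down is harmless for the first cone by
  the height condition, and for the second one because it adds a nonnegative multiple of \<open>e\<close>.\<close>

lemma split_along_common_line:
  fixes \<Lambda> V W :: "'a::euclidean_space set"
  assumes V: "lattice_cone \<Lambda> V" and W: "lattice_cone \<Lambda> W"
    and e: "e \<in> convex_cone hull V \<inter> \<Lambda>" "e \<in> convex_cone hull W"
    and line: "span V \<inter> span W \<subseteq> range (\<lambda>t. t *\<^sub>R e)"
    and height: "height_le_1_over_all_facets (convex_cone hull V \<inter> \<Lambda>) e"
    and u: "u \<in> span V \<inter> \<Lambda>" and v: "v \<in> span W \<inter> \<Lambda>"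
    and c: "c \<in> convex_cone hull V" and d: "d \<in> convex_cone hull W" and eq: "u + v = c + d"
  shows "\<exists>x\<in>convex_cone hull V \<inter> \<Lambda>. \<exists>y\<in>convex_cone hull W \<inter> \<Lambda>. u + v = x + y"
proof -
  interpret V: lattice_cone \<Lambda> V by (rule V)
  interpret W: lattice_cone \<Lambda> W by (rule W)
  have "c - u = v - d" using eq by (simp add: algebra_simps)
  moreover have "c - u \<in> span V" using c u V.cone_subset_span by (auto intro: span_diff)
  moreover have "v - d \<in> span W" using d v W.cone_subset_span by (auto intro: span_diff)
  ultimately obtain t where t: "c - u = t *\<^sub>R e" using line by auto
  then have c': "c = u + t *\<^sub>R e" by (simp add: algebra_simps)
  then have d': "d = v - t *\<^sub>R e" using eq by (simp add: algebra_simps)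
  let ?x = "u + of_int \<lfloor>t\<rfloor> *\<^sub>R e" and ?y = "v - of_int \<lfloor>t\<rfloor> *\<^sub>R e"
  have "?x \<in> convex_cone hull V"
    using V.height_le_1_imp_floor[OF height e(1) u] c c' by blast
  moreover have "d + frac t *\<^sub>R e \<in> convex_cone hull W"
    using d e(2) by (intro convex_cone_hull_add convex_cone_hull_mul) simp_all
  then have "?y \<in> convex_cone hull W"
    by (simp add: d' frac_def scaleR_left_diff_distrib)
  moreover have "?x \<in> \<Lambda>" "?y \<in> \<Lambda>"
    using u v e(1) by (auto intro: V.lattice_add V.lattice_diff V.lattice_of_int)
  moreover have "u + v = ?x + ?y" by simp
  ultimately show ?thesis by blast
qed

text \<open>The geometric core. If both cones violate the height condition, the two half gaps \<open>u\<close> and \<open>v\<close>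
  combine to the point \<open>u + v + e\<close>: its splitting into two halves is real but not integral.\<close>

lemma height_le_1_iff_lattice_points_add:
  fixes \<Lambda> V W :: "'a::euclidean_space set"
  assumes V: "lattice_cone \<Lambda> V" and W: "lattice_cone \<Lambda> W"
    and e: "e \<in> convex_cone hull V" "e \<in> convex_cone hull W" "e \<in> \<Lambda>"
    and line: "span V \<inter> span W \<subseteq> range (\<lambda>t. t *\<^sub>R e)"
    and primitive: "\<And>t. t *\<^sub>R e \<in> \<Lambda> \<Longrightarrow> t \<in> \<int>"
    and lattice_split: "\<And>z. z \<in> span (V \<union> W) \<inter> \<Lambda> \<Longrightarrow> \<exists>u\<in>span V \<inter> \<Lambda>. \<exists>v\<in>span W \<inter> \<Lambda>. z = u + v"
  shows "height_le_1_over_all_facets (convex_cone hull V \<inter> \<Lambda>) e \<or>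
         height_le_1_over_all_facets (convex_cone hull W \<inter> \<Lambda>) e \<longleftrightarrow>
         convex_cone hull (V \<union> W) \<inter> \<Lambda> =
           {x + y |x y. x \<in> convex_cone hull V \<inter> \<Lambda> \<and> y \<in> convex_cone hull W \<inter> \<Lambda>}"
    (is "?hV \<or> ?hW \<longleftrightarrow> ?CVW \<inter> \<Lambda> = ?sum")
proof -
  interpret V: lattice_cone \<Lambda> V by (rule V)
  interpret W: lattice_cone \<Lambda> W by (rule W)
  have CVW: "z \<in> ?CVW \<longleftrightarrow> (\<exists>c\<in>V.C. \<exists>d\<in>W.C. z = c + d)" for z
    by (auto simp: convex_cone_hull_Un)
  have sum_sub: "?sum \<subseteq> ?CVW \<inter> \<Lambda>"
    using CVW V.lattice_add by blast
  show ?thesis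
  proof
    assume h: "?hV \<or> ?hW"
    have "z \<in> ?sum" if z: "z \<in> ?CVW \<inter> \<Lambda>" for z
    proof -
      obtain c d where cd: "c \<in> V.C" "d \<in> W.C" "z = c + d" using z CVW by blast
      have "z \<in> span (V \<union> W)"
        using z span_superset[of ?CVW] by (auto simp: span_convex_cone_hull)
      then obtain u v where uv: "u \<in> span V \<inter> \<Lambda>" "v \<in> span W \<inter> \<Lambda>" "z = u + v"
        using lattice_split[of z] z by blast
      from h have "\<exists>x\<in>V.C \<inter> \<Lambda>. \<exists>y\<in>W.C \<inter> \<Lambda>. u + v = x + y"
      proof
        assume ?hV
        then show ?thesis
          using split_along_common_line[OF V W _ e(2) line _ uv(1,2) cd(1,2)] e uv(3) cd(3) by simp
      next
        assume ?hW
        have "\<exists>x\<in>W.C \<inter> \<Lambda>. \<exists>y\<in>V.C \<inter> \<Lambda>. v + u = x + y"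
          using split_along_common_line[OF W V _ e(1) _ \<open>?hW\<close> uv(2,1) cd(2,1)] e line uv(3) cd(3)
          by (simp add: Int_commute add.commute)
        then show ?thesis by (metis add.commute)
      qed
      then show ?thesis using uv(3) by blast
    qed
    then show "?CVW \<inter> \<Lambda> = ?sum" using sum_sub by blast
  next
    assume eq: "?CVW \<inter> \<Lambda> = ?sum"
    show "?hV \<or> ?hW"
    proof (rule ccontr)
      assume "\<not> ?thesis"
      then have nV: "\<not> ?hV" and nW: "\<not> ?hW" by auto
      obtain u where u: "u \<in> span V \<inter> \<Lambda>" "u + (1/2) *\<^sub>R e \<in> V.C" "u \<notin> V.C"
        using V.height_gt_1_imp_half_gap[OF nV] e by blast
      obtain v where v: "v \<in> span W \<inter> \<Lambda>" "v + (1/2) *\<^sub>R e \<in> W.C" "v \<notin> W.C"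
        using W.height_gt_1_imp_half_gap[OF nW] e by blast
      have "u + v + e = (u + (1/2) *\<^sub>R e) + (v + (1/2) *\<^sub>R e)"
        using scaleR_left_distrib[of "1/2" "1/2" e] by simp
      then have "u + v + e \<in> ?CVW" using CVW u(2) v(2) by blast
      moreover have "u + v + e \<in> \<Lambda>" using u v e by (intro V.lattice_add) auto
      ultimately have "u + v + e \<in> ?sum" using eq by blast
      then obtain x y where xy: "x \<in> V.C" "x \<in> \<Lambda>" "y \<in> W.C" "y \<in> \<Lambda>" "u + v + e = x + y"
        by auto
      have "x - u = v + e - y" using xy(5) by (simp add: algebra_simps)
      moreover have "x - u \<in> span V" using xy(1) u(1) V.cone_subset_span by (auto intro: span_diff)
      moreover have "v + e - y \<in> span W"
        using xy(3) v(1) e(2) W.cone_subset_span by (auto intro: span_diff span_add)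
      ultimately obtain t where t: "x - u = t *\<^sub>R e" using line by auto
      moreover have "x - u \<in> \<Lambda>" using xy(2) u(1) V.lattice_diff by blast
      ultimately obtain n :: int where n: "t = of_int n" using primitive[of t] by (auto elim: Ints_cases)
      have x: "x = u + of_int n *\<^sub>R e" using t n by (simp add: algebra_simps)
      then have y: "y = v + of_int (1 - n) *\<^sub>R e" using xy(5) by (simp add: algebra_simps)
      \<comment> \<open>Adding a nonnegative multiple of \<open>e\<close> to \<open>x\<close> or to \<open>y\<close>, whichever is possible, leads back to
        \<open>u\<close> or \<open>v\<close>, which lie outside the cones.\<close>
      show False
      proof (cases "n \<le> 0")
        case True
        then have "x + of_int (- n) *\<^sub>R e \<in> V.C"
          using xy(1) e(1) by (intro convex_cone_hull_add convex_cone_hull_mul) auto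
        then show False using u(3) x by simp
      next
        case False
        then have "y + of_int (n - 1) *\<^sub>R e \<in> W.C"
          using xy(3) e(2) by (intro convex_cone_hull_add convex_cone_hull_mul) auto
        moreover have "y + of_int (n - 1) *\<^sub>R e = v" by (simp add: y algebra_simps)
        ultimately show False using v(3) by simp
      qed
    qed
  qed
qed

section \<open>Generating series of sets of lattice points\<close>

definition degree_slice :: "((int ^ 'm) \<times> int) set \<Rightarrow> nat \<Rightarrow> (int ^ 'm) set" where
  "degree_slice S n = {x. (x, int n) \<in> S}"

text \<open>An infinite slice would contribute the default value \<open>0\<close> of an infinite sum, and points of negative degree
  leave no trace in the series; hence the hypotheses of the lemmas below.\<close>

definition set_series :: "((int ^ 'm) \<times> int) set \<Rightarrow> 'm series" where
  "set_series S = Abs_fps (\<lambda>n. \<Sum>x\<in>degree_slice S n. Poly_Mapping.single x 1)"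

lemma ehrhart_series_eq: "ehrhart_series P = set_series (ehrhart_monoid P)"
  by (simp add: ehrhart_series_def set_series_def degree_slice_def)

lemma lookup_set_series:
  assumes "finite (degree_slice S n)"
  shows "Poly_Mapping.lookup (fps_nth (set_series S) n) x = (if (x, int n) \<in> S then 1 else 0)"
proof -
  have "Poly_Mapping.lookup (fps_nth (set_series S) n) x =
          (\<Sum>y\<in>degree_slice S n. if y = x then 1 else 0)"
    unfolding set_series_def fps_nth_Abs_fps lookup_sum
    by (intro sum.cong refl) (simp add: lookup_single when_def)
  then show ?thesis using assms by (simp add: degree_slice_def)
qed

lemma set_series_eq_iff:
  fixes A B :: "((int ^ 'm) \<times> int) set"
  assumes "\<And>n. finite (degree_slice A n)" "\<And>n. finite (degree_slice B n)"
    and deg: "A \<subseteq> UNIV \<times> {0..}" "B \<subseteq> UNIV \<times> {0..}"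
  shows "set_series A = set_series B \<longleftrightarrow> A = B"
proof
  assume eq: "set_series A = set_series B"
  have iff: "(x, int n) \<in> A \<longleftrightarrow> (x, int n) \<in> B" for x n
    using lookup_set_series[OF assms(1), of n x] lookup_set_series[OF assms(2), of n x]
    by (metis eq zero_neq_one)
  have "z \<in> A \<longleftrightarrow> z \<in> B" for z
  proof (cases "snd z \<ge> 0")
    case True
    then have "z = (fst z, int (nat (snd z)))" by simp
    then show ?thesis using iff by metis
  next
    case False
    then show ?thesis using deg by (cases z) auto
  qed
  then show "A = B" by blast
qed simp

lemma set_series_times:
  fixes A B :: "((int ^ 'm) \<times> int) set"
  assumes finA: "\<And>n. finite (degree_slice A n)" and finB: "\<And>n. finite (degree_slice B n)"
    and degA: "A \<subseteq> UNIV \<times> {0..}" and degB: "B \<subseteq> UNIV \<times> {0..}"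
    and inj: "inj_on (\<lambda>(a, b). a + b) (A \<times> B)"
  shows "set_series A * set_series B = set_series {a + b |a b. a \<in> A \<and> b \<in> B}"
proof (rule fps_ext)
  fix n
  let ?S = "{a + b |a b. a \<in> A \<and> b \<in> B}"
  let ?I = "SIGMA i:{0..n}. degree_slice A i \<times> degree_slice B (n - i)"
  have "fps_nth (set_series A * set_series B) n =
          (\<Sum>i=0..n. \<Sum>(x, y)\<in>degree_slice A i \<times> degree_slice B (n - i). Poly_Mapping.single (x + y) 1)"
    by (simp add: fps_mult_nth set_series_def sum_product sum.cartesian_product mult_single)
  also have "\<dots> = (\<Sum>(i, x, y)\<in>?I. Poly_Mapping.single (x + y) 1)"
    using finA finB by (subst sum.Sigma) auto
  also have "\<dots> = (\<Sum>z\<in>degree_slice ?S n. Poly_Mapping.single z 1)"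
  proof (rule sum.reindex_bij_betw[where h = "\<lambda>(i, x, y). x + y", THEN trans[rotated]])
    show "bij_betw (\<lambda>(i, x, y). x + y) ?I (degree_slice ?S n)"
    proof (rule bij_betwI')
      fix s t assume s: "s \<in> ?I" and t: "t \<in> ?I"
      obtain i x y j x' y' where [simp]: "s = (i, x, y)" "t = (j, x', y')"
        by (metis prod_cases3)
      show "((\<lambda>(i, x, y). x + y) s = (\<lambda>(i, x, y). x + y) t) = (s = t)"
      proof
        assume "(\<lambda>(i, x, y). x + y) s = (\<lambda>(i, x, y). x + y) t"
        then have "(x, int i) + (y, int (n - i)) = (x', int j) + (y', int (n - j))"
          using s t by auto
        moreover have "((x, int i), (y, int (n - i))) \<in> A \<times> B"
          "((x', int j), (y', int (n - j))) \<in> A \<times> B"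
          using s t by (auto simp: degree_slice_def)
        ultimately have "((x, int i), (y, int (n - i))) = ((x', int j), (y', int (n - j)))"
          using inj unfolding inj_on_def by fastforce
        then show "s = t" by simp
      qed simp
    next
      fix s assume "s \<in> ?I"
      then obtain i x y where s: "s = (i, x, y)" "i \<le> n" "(x, int i) \<in> A" "(y, int (n - i)) \<in> B"
        by (auto simp: degree_slice_def)
      then have "(x + y, int n) = (x, int i) + (y, int (n - i))" by simp
      then have "x + y \<in> degree_slice ?S n"
        using s(3,4) unfolding degree_slice_def by blast
      then show "(\<lambda>(i, x, y). x + y) s \<in> degree_slice ?S n"
        using s(1) by simp
    next
      fix z assume "z \<in> degree_slice ?S n"
      then obtain a b where ab: "a \<in> A" "b \<in> B" "(z, int n) = a + b"
        by (auto simp: degree_slice_def)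
      let ?i = "nat (snd a)"
      have deg: "0 \<le> snd a" "0 \<le> snd b" "snd a + snd b = int n"
        using ab degA degB by (auto simp: prod_eq_iff)
      then have "?i \<le> n" "int ?i = snd a" "int (n - ?i) = snd b" by auto
      moreover have "z = fst a + fst b" using ab(3) by (simp add: prod_eq_iff)
      ultimately show "\<exists>s\<in>?I. z = (\<lambda>(i, x, y). x + y) s"
        using ab by (intro bexI[of _ "(?i, fst a, fst b)"]) (auto simp: degree_slice_def)
    qed
  qed (auto intro!: sum.cong)
  finally show "fps_nth (set_series A * set_series B) n = fps_nth (set_series ?S) n"
    by (simp add: set_series_def)
qed

lemma set_series_diff_translate:
  fixes A :: "((int ^ 'm) \<times> int) set"
  assumes finA: "\<And>n. finite (degree_slice A n)" and degA: "A \<subseteq> UNIV \<times> {0..}"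
    and sub: "(\<lambda>a. (q, int k) + a) ` A \<subseteq> A"
  shows "(1 - monomial (q, k)) * set_series A = set_series (A - (\<lambda>a. (q, int k) + a) ` A)"
proof (rule fps_ext)
  fix n
  let ?T = "(\<lambda>a. (q, int k) + a) ` A"
  have sl: "degree_slice (A - ?T) n = degree_slice A n - degree_slice ?T n"
    by (auto simp: degree_slice_def)
  have subsl: "degree_slice ?T n \<subseteq> degree_slice A n"
    using sub by (auto simp: degree_slice_def)
  have T: "degree_slice ?T n = (if n < k then {} else (\<lambda>x. q + x) ` degree_slice A (n - k))"
  proof -
    have mem: "z \<in> degree_slice ?T n \<longleftrightarrow> k \<le> n \<and> (z - q, int (n - k)) \<in> A" for z
    proof
      assume "z \<in> degree_slice ?T n"
      then obtain a where a: "a \<in> A" "(z, int n) = (q, int k) + a"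
        by (auto simp: degree_slice_def)
      moreover have "0 \<le> snd a" using a(1) degA by auto
      moreover have "int n = int k + snd a" using a(2) by (simp add: prod_eq_iff)
      ultimately have "k \<le> n" "a = (z - q, int (n - k))"
        by (auto simp: prod_eq_iff)
      then show "k \<le> n \<and> (z - q, int (n - k)) \<in> A" using a(1) by simp
    next
      assume *: "k \<le> n \<and> (z - q, int (n - k)) \<in> A"
      then have "(z, int n) = (q, int k) + (z - q, int (n - k))" by simp
      then show "z \<in> degree_slice ?T n" using * unfolding degree_slice_def by blast
    qed
    have mem': "z \<in> (\<lambda>x. q + x) ` degree_slice A (n - k) \<longleftrightarrow> (z - q, int (n - k)) \<in> A" for z
      by (force simp: degree_slice_def image_iff)
    show ?thesis
    proof (cases "n < k")
      case True
      then show ?thesis using mem by auto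
    next
      case False
      then have "degree_slice ?T n = (\<lambda>x. q + x) ` degree_slice A (n - k)"
        using mem mem' not_less by blast
      then show ?thesis using False by simp
    qed
  qed
  have "fps_nth (monomial (q, k) * set_series A) n = (\<Sum>x\<in>degree_slice ?T n. Poly_Mapping.single x 1)"
    by (simp add: T monomial_def mult.assoc fps_X_power_mult_nth set_series_def
        sum_distrib_left mult_single sum.reindex)
  then show "fps_nth ((1 - monomial (q, k)) * set_series A) n = fps_nth (set_series (A - ?T)) n"
    using finA[of n] subsl by (simp add: left_diff_distrib sl set_series_def sum_diff)
qed

text \<open>With \<open>e = (q, k)\<close>, multiplication of the series of \<open>A\<close> by \<open>1 - T\<^sup>e\<close> leaves the elements of \<open>A\<close> that are
  minimal with respect to shifts by \<open>e\<close>, and each fibre of the addition on \<open>A \<times> B\<close> contains exactly one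
  pair whose first component is minimal. Uniqueness comes from the last hypothesis, which says that a
  fibre is a chain of shifts; existence holds since each shift back lowers the degree by \<open>k > 0\<close>.\<close>

lemma set_series_sumset:
  fixes A B :: "((int ^ 'm) \<times> int) set"
  assumes finA: "\<And>n. finite (degree_slice A n)" and finB: "\<And>n. finite (degree_slice B n)"
    and degA: "A \<subseteq> UNIV \<times> {0..}" and degB: "B \<subseteq> UNIV \<times> {0..}"
    and shiftA: "\<And>a. a \<in> A \<Longrightarrow> (q, int k) + a \<in> A" and shiftB: "\<And>b. b \<in> B \<Longrightarrow> (q, int k) + b \<in> B"
    and "k > 0"
    and fibre: "\<And>a b a' b'. \<lbrakk>a \<in> A; b \<in> B; a' \<in> A; b' \<in> B; a + b = a' + b'\<rbrakk> \<Longrightarrow>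
      \<exists>n. a = (((+) (q, int k)) ^^ n) a' \<or> a' = (((+) (q, int k)) ^^ n) a"
  shows "(1 - monomial (q, k)) * set_series A * set_series B = set_series {a + b |a b. a \<in> A \<and> b \<in> B}"
proof -
  let ?e = "(q, int k)"
  define D where "D = A - (\<lambda>a. ?e + a) ` A"
  have DA: "D \<subseteq> A" by (auto simp: D_def)
  have shifts: "(((+) ?e) ^^ n) a \<in> A" if "a \<in> A" for a n
    using that by (induction n) (auto simp: shiftA)
  have minimal: "a = a'" if "a \<in> D" "a' \<in> A" "a = (((+) ?e) ^^ n) a'" for a a' n
  proof (cases n)
    case 0
    then show ?thesis using that by simp
  next
    case (Suc m)
    then have "a = ?e + (((+) ?e) ^^ m) a'" using that(3) by simp
    then have "a \<notin> D" using shifts[OF that(2), of m] unfolding D_def by blast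
    then show ?thesis using that(1) by simp
  qed
  have "inj_on (\<lambda>(a, b). a + b) (D \<times> B)"
  proof (rule inj_onI)
    fix s t assume s: "s \<in> D \<times> B" and t: "t \<in> D \<times> B"
      and "(\<lambda>(a, b). a + b) s = (\<lambda>(a, b). a + b) t"
    then have eq: "fst s + snd s = fst t + snd t" by (simp add: case_prod_beta)
    have "\<exists>n. fst s = (((+) ?e) ^^ n) (fst t) \<or> fst t = (((+) ?e) ^^ n) (fst s)"
      using s t eq DA by (intro fibre) auto
    then have "fst s = fst t"
      using minimal s t DA by (metis mem_Times_iff subsetD)
    then show "s = t" using eq by (simp add: prod_eq_iff)
  qed
  moreover have "finite (degree_slice D n)" for n
    using DA by (intro finite_subset[OF _ finA[of n]]) (auto simp: degree_slice_def)
  ultimately have "set_series D * set_series B = set_series {a + b |a b. a \<in> D \<and> b \<in> B}"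
    using DA degA by (intro set_series_times finB degB) auto
  moreover have "{a + b |a b. a \<in> D \<and> b \<in> B} = {a + b |a b. a \<in> A \<and> b \<in> B}"
  proof -
    have "\<exists>a'\<in>D. \<exists>b'\<in>B. a + b = a' + b'" if "a \<in> A" "b \<in> B" for a b
      using that
    proof (induction "nat (snd a)" arbitrary: a b rule: less_induct)
      case less
      show ?case
      proof (cases "a \<in> D")
        case True
        then show ?thesis using less.prems by blast
      next
        case False
        then obtain a' where a': "a' \<in> A" "a = ?e + a'"
          using less.prems by (auto simp: D_def)
        have "0 \<le> snd a'" using a'(1) degA by auto
        then have "nat (snd a') < nat (snd a)" using a'(2) \<open>k > 0\<close> by simp
        then have "\<exists>c\<in>D. \<exists>d\<in>B. a' + (?e + b) = c + d"
          using less.hyps a'(1) shiftB[OF less.prems(2)] by blast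
        then show ?thesis using a'(2) by (simp add: add.assoc add.left_commute)
      qed
    qed
    then show ?thesis using DA by blast
  qed
  moreover have "(1 - monomial (q, k)) * set_series A = set_series D"
    unfolding D_def using finA degA shiftA by (intro set_series_diff_translate) auto
  ultimately show ?thesis by simp
qed

section \<open>The cone over a polytope\<close>

text \<open>The lattice \<open>\<int>\<^sup>m\<^sup>+\<^sup>1\<close> inside the real space in which the cones live.\<close>

definition embed :: "(int ^ 'm) \<times> int \<Rightarrow> (real ^ 'm) \<times> real" where
  "embed = (\<lambda>(x, k). (vec_of_int x, of_int k))"

lemma vec_of_int_add: "vec_of_int (x + y) = vec_of_int x + vec_of_int y"
  by (simp add: vec_of_int_def vec_eq_iff)

lemma vec_of_int_diff: "vec_of_int (x - y) = vec_of_int x - vec_of_int y"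
  by (simp add: vec_of_int_def vec_eq_iff)

lemma vec_of_int_eq_iff: "vec_of_int x = vec_of_int y \<longleftrightarrow> x = y"
  by (simp add: vec_of_int_def vec_eq_iff)

lemma embed_add: "embed (a + b) = embed a + embed b"
  by (simp add: embed_def vec_of_int_add split: prod.split)

lemma embed_diff: "embed (a - b) = embed a - embed b"
  by (simp add: embed_def vec_of_int_diff split: prod.split)

lemma embed_eq_iff: "embed a = embed b \<longleftrightarrow> a = b"
  by (cases a; cases b) (simp add: embed_def vec_of_int_eq_iff)

lemma embed_0: "embed 0 = 0"
  using embed_diff[of 0 0] by simp

lemma zero_in_range_embed: "0 \<in> range embed"
  by (rule image_eqI[of _ _ 0]) (simp_all add: embed_0)

lemma add_in_range_embed: "x \<in> range embed \<Longrightarrow> y \<in> range embed \<Longrightarrow> x + y \<in> range embed"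
  by (auto simp flip: embed_add)

lemma diff_in_range_embed: "x \<in> range embed \<Longrightarrow> y \<in> range embed \<Longrightarrow> x - y \<in> range embed"
  by (auto simp flip: embed_diff)

lemma embed_iterate: "embed ((((+) c) ^^ n) a) = embed a + real n *\<^sub>R embed c"
  by (induction n) (simp_all add: embed_add algebra_simps)

lemma finite_lattice_Int_bounded:
  fixes B :: "((real ^ 'm) \<times> real) set"
  assumes "bounded B"
  shows "finite (range embed \<inter> B)"
proof -
  have "{a. embed a \<in> B} \<subseteq> {x. vec_of_int x \<in> fst ` B} \<times> {j. real_of_int j \<in> snd ` B}"
    by (force simp: embed_def)
  moreover have "finite {x :: int ^ 'm. vec_of_int x \<in> fst ` B}"
    using assms by (intro finite_bounded_vec_of_int bounded_fst)
  moreover have "finite {j. real_of_int j \<in> snd ` B}"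
  proof -
    obtain b where b: "\<And>y. y \<in> snd ` B \<Longrightarrow> norm y \<le> b"
      using bounded_snd[OF assms] unfolding bounded_iff by blast
    have "{j. real_of_int j \<in> snd ` B} \<subseteq> {- \<lceil>b\<rceil>..\<lceil>b\<rceil>}"
    proof
      fix j assume "j \<in> {j. real_of_int j \<in> snd ` B}"
      then have "\<bar>real_of_int j\<bar> \<le> b" using b[of "real_of_int j"] by simp
      then show "j \<in> {- \<lceil>b\<rceil>..\<lceil>b\<rceil>}" by (simp add: abs_le_iff) linarith
    qed
    then show ?thesis using finite_subset by blast
  qed
  ultimately have "finite {a. embed a \<in> B}"
    using finite_subset finite_cartesian_product by blast
  then have "finite (embed ` {a. embed a \<in> B})" by (rule finite_imageI)
  then show ?thesis by (rule finite_subset[rotated]) auto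
qed

definition polytope_cone :: "(real ^ 'm) set \<Rightarrow> ((real ^ 'm) \<times> real) set" where
  "polytope_cone P = convex_cone hull (P \<times> {1})"

lemma mem_polytope_cone:
  assumes "convex P" "P \<noteq> {}"
  shows "(x, s) \<in> polytope_cone P \<longleftrightarrow> 0 \<le> s \<and> x \<in> (\<lambda>p. s *\<^sub>R p) ` P"
proof -
  have "convex (P \<times> {1::real})"
    using assms(1) by (intro convex_Times) auto
  then have "convex hull (P \<times> {1::real}) = P \<times> {1}" by (simp add: hull_same)
  then have "polytope_cone P = (\<Union>x\<in>P \<times> {1}. \<Union>c\<in>{0..}. {c *\<^sub>R x})"
    using assms(2) unfolding polytope_cone_def
    by (subst convex_cone_hull_convex_hull_nonempty) auto
  then show ?thesis by auto
qed

lemma ehrhart_monoid_eq: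
  assumes "convex P" "P \<noteq> {}"
  shows "ehrhart_monoid P = {a. embed a \<in> polytope_cone P}"
  using mem_polytope_cone[OF assms] by (auto simp: ehrhart_monoid_def embed_def)

lemma real_ehrhart_monoid_eq:
  assumes "convex P" "P \<noteq> {}"
  shows "real_ehrhart_monoid P = polytope_cone P \<inter> range embed"
proof -
  have "real_ehrhart_monoid P = embed ` ehrhart_monoid P"
    by (simp add: real_ehrhart_monoid_def embed_def)
  then show ?thesis by (auto simp: ehrhart_monoid_eq[OF assms])
qed

lemma convex_cone_hull_of_convex_hull: "convex_cone hull (convex hull S) = convex_cone hull S"
  unfolding convex_cone_hull_separate hull_hull ..

lemma convex_hull_Times_1: "convex hull (S \<times> {1::real}) = (convex hull S) \<times> {1}"
  by (simp add: convex_hull_Times)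

lemma polytope_cone_convex_hull: "polytope_cone (convex hull S) = convex_cone hull (S \<times> {1})"
  unfolding polytope_cone_def convex_hull_Times_1[symmetric] by (rule convex_cone_hull_of_convex_hull)

text \<open>The product of the denominators of the coordinates is a common denominator.\<close>

lemma rational_vector_multiple:
  fixes v :: "real ^ 'm"
  assumes "\<And>i. v $ i \<in> \<rat>"
  shows "\<exists>N::nat. 0 < N \<and> real N *\<^sub>R v \<in> int_lattice"
proof -
  have "\<exists>d::nat. 0 < d \<and> real d * v $ i \<in> \<int>" for i
  proof -
    obtain m n where "v $ i = of_int m / of_int n" "n > 0"
      using Rats_cases'[OF assms[of i]] by metis
    then have "real (nat n) * v $ i = of_int m" by simp
    then show ?thesis using \<open>n > 0\<close> by (intro exI[of _ "nat n"]) auto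
  qed
  then obtain d where d: "\<And>i. 0 < d i" "\<And>i. real (d i) * v $ i \<in> \<int>" by metis
  define N where "N = (\<Prod>i\<in>UNIV. d i)"
  have "real N * v $ i \<in> \<int>" for i
  proof -
    have "N = d i * (\<Prod>j\<in>UNIV - {i}. d j)" unfolding N_def by (intro prod.remove) auto
    then have "real N * v $ i = real (\<Prod>j\<in>UNIV - {i}. d j) * (real (d i) * v $ i)" by simp
    then show ?thesis using d(2)[of i] by (simp only: Ints_mult Ints_of_nat)
  qed
  then have "\<forall>i. \<exists>z. real N * v $ i = of_int z" by (meson Ints_cases)
  then obtain z where z: "\<And>i. real N * v $ i = of_int (z i)" by metis
  have "real N *\<^sub>R v = vec_of_int (\<chi> i. z i)"
    by (simp add: vec_of_int_def vec_eq_iff z)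
  moreover have "0 < N" unfolding N_def using d(1) by (simp add: prod_pos)
  ultimately show ?thesis by blast
qed

lemma convex_cone_hull_rescale:
  assumes "\<And>v. v \<in> S \<Longrightarrow> 0 < c v"
  shows "convex_cone hull ((\<lambda>v. c v *\<^sub>R v) ` S) = convex_cone hull S" (is "?lhs = ?rhs")
proof
  show "?lhs \<subseteq> ?rhs"
  proof (rule hull_minimal)
    have "c v *\<^sub>R v \<in> ?rhs" if "v \<in> S" for v
      using assms[OF that] that by (intro convex_cone_hull_mul hull_inc) auto
    then show "(\<lambda>v. c v *\<^sub>R v) ` S \<subseteq> ?rhs" by blast
  qed (rule convex_cone_convex_cone_hull)
  have "v \<in> ?lhs" if "v \<in> S" for v
  proof -
    have "inverse (c v) *\<^sub>R (c v *\<^sub>R v) \<in> ?lhs"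
      using assms[OF that] that by (intro convex_cone_hull_mul hull_inc) auto
    then show ?thesis using assms[OF that] by simp
  qed
  then show "?rhs \<subseteq> ?lhs"
    by (intro hull_minimal convex_cone_convex_cone_hull) auto
qed

lemma rational_polytope_lattice_cone:
  fixes P :: "(real ^ 'm) set"
  assumes "rational_polytope P"
  obtains V where "lattice_cone (range embed) V" "convex_cone hull V = polytope_cone P"
proof -
  obtain S where S: "finite S" "\<And>v i. v \<in> S \<Longrightarrow> v $ i \<in> \<rat>" "P = convex hull S"
    using assms unfolding rational_polytope_def by blast
  obtain N :: "real ^ 'm \<Rightarrow> nat" where N: "\<And>v. v \<in> S \<Longrightarrow> 0 < N v \<and> real (N v) *\<^sub>R v \<in> int_lattice"
    using rational_vector_multiple S(2) by metis
  let ?V = "(\<lambda>z. real (N (fst z)) *\<^sub>R z) ` (S \<times> {1::real})"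
  show thesis
  proof
    show "lattice_cone (range embed) ?V"
    proof
      show "finite ?V" using S(1) by simp
      show "?V \<subseteq> range embed"
      proof
        fix z assume "z \<in> ?V"
        then obtain v where v: "v \<in> S" "z = (real (N v) *\<^sub>R v, real (N v))" by auto
        then obtain x where "real (N v) *\<^sub>R v = vec_of_int x" using N by blast
        then have "z = embed (x, int (N v))" using v by (simp add: embed_def)
        then show "z \<in> range embed" by blast
      qed
    qed (fact zero_in_range_embed diff_in_range_embed finite_lattice_Int_bounded)+
    show "convex_cone hull ?V = polytope_cone P"
      unfolding S(3) polytope_cone_convex_hull using N by (intro convex_cone_hull_rescale) auto
  qed
qed

text \<open>The span of \<open>P \<times> {1}\<close> consists of all \<open>(x, s)\<close> for which \<open>x - s p\<^sub>0\<close> lies in the linear space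
  parallel to the affine hull of \<open>P\<close>.\<close>

lemma span_Times_1_iff:
  fixes P :: "(real ^ 'm) set"
  assumes "p0 \<in> P"
  shows "(y, 1) \<in> span (P \<times> {1::real}) \<longleftrightarrow> y \<in> affine hull P"
proof
  let ?D = "span ((\<lambda>x. - p0 + x) ` P)"
  let ?T = "{z. fst z - snd z *\<^sub>R p0 \<in> ?D}"
  have aff: "affine hull P = (\<lambda>x. p0 + x) ` ?D"
    by (rule affine_hull_span_gen[OF hull_inc[OF assms]])
  have "subspace ?T"
  proof (rule subspaceI)
    show "0 \<in> ?T" by (simp add: span_zero)
    show "x + y \<in> ?T" if "x \<in> ?T" "y \<in> ?T" for x y
      using span_add[of "fst x - snd x *\<^sub>R p0" _ "fst y - snd y *\<^sub>R p0"] that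
      by (simp add: algebra_simps)
    show "c *\<^sub>R x \<in> ?T" if "x \<in> ?T" for c x
      using span_mul[of "fst x - snd x *\<^sub>R p0" _ c] that by (simp add: algebra_simps)
  qed
  moreover have "P \<times> {1} \<subseteq> ?T"
    by (auto intro!: span_base)
  ultimately have T: "span (P \<times> {1}) \<subseteq> ?T"
    by (simp add: span_minimal)
  show "y \<in> affine hull P" if "(y, 1) \<in> span (P \<times> {1::real})"
  proof -
    have "y - p0 \<in> ?D" using T that by force
    then have "p0 + (y - p0) \<in> affine hull P" unfolding aff by (rule imageI)
    then show ?thesis by simp
  qed
next
  have "affine {y. (y, 1) \<in> span (P \<times> {1::real})}"
    unfolding affine_def
  proof (intro ballI allI impI, unfold mem_Collect_eq)
    fix x y :: "real ^ 'm" and u v :: real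
    assume xy: "(x, 1) \<in> span (P \<times> {1::real})" "(y, 1) \<in> span (P \<times> {1::real})" and "u + v = 1"
    then have "(u *\<^sub>R x + v *\<^sub>R y, 1) = u *\<^sub>R (x, 1::real) + v *\<^sub>R (y, 1)" by simp
    then show "(u *\<^sub>R x + v *\<^sub>R y, 1) \<in> span (P \<times> {1::real})"
      using span_add[OF span_mul[OF xy(1), of u] span_mul[OF xy(2), of v]] by (simp only:)
  qed
  then have "affine hull P \<subseteq> {y. (y, 1) \<in> span (P \<times> {1::real})}"
    by (intro hull_minimal) (auto intro: span_base)
  then show "y \<in> affine hull P \<Longrightarrow> (y, 1) \<in> span (P \<times> {1::real})" by blast
qed

lemma span_Int_eq_line:
  fixes P Q :: "(real ^ 'm) set"
  assumes "affine hull P \<inter> affine hull Q = {p0}" and "p0 \<in> P \<inter> Q"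
  shows "span (P \<times> {1}) \<inter> span (Q \<times> {1}) \<subseteq> range (\<lambda>t. t *\<^sub>R (p0, 1::real))"
proof
  fix z assume z: "z \<in> span (P \<times> {1::real}) \<inter> span (Q \<times> {1})"
  obtain x s where xs: "z = (x, s)" by (cases z)
  \<comment> \<open>Adding a multiple of \<open>(p\<^sub>0, 1)\<close> moves the point to degree 1; this also covers \<open>s = 0\<close>.\<close>
  have "z + (1 - s) *\<^sub>R (p0, 1) \<in> span (P \<times> {1}) \<inter> span (Q \<times> {1})"
  proof -
    have "(p0, 1) \<in> span (P \<times> {1::real}) \<inter> span (Q \<times> {1})"
      using assms(2) by (simp add: span_base)
    then show ?thesis using z by (blast intro: span_add span_mul)
  qed
  then have "x + (1 - s) *\<^sub>R p0 \<in> affine hull P \<inter> affine hull Q"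
    using span_Times_1_iff[of p0 P "x + (1 - s) *\<^sub>R p0"] span_Times_1_iff[of p0 Q "x + (1 - s) *\<^sub>R p0"] assms(2)
    by (simp add: xs)
  then have "x = s *\<^sub>R p0" using assms(1) by (simp add: algebra_simps)
  then have "z = s *\<^sub>R (p0, 1)" by (simp add: xs)
  then show "z \<in> range (\<lambda>t. t *\<^sub>R (p0, 1::real))" by blast
qed

lemma ehrhart_degree_nonneg: "ehrhart_monoid P \<subseteq> UNIV \<times> {0..}"
  by (auto simp: ehrhart_monoid_def)

lemma finite_ehrhart_slice:
  assumes "bounded P"
  shows "finite (degree_slice (ehrhart_monoid P) n)"
proof -
  have "bounded ((\<lambda>p. real_of_int (int n) *\<^sub>R p) ` P)"
    using assms by (rule bounded_scaling)
  from finite_bounded_vec_of_int[OF this] show ?thesis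
    by (simp add: degree_slice_def ehrhart_monoid_def)
qed

section \<open>The lattice over the convex hull of two polytopes\<close>

text \<open>The sums of lattice points of the two spans form a group, and an integral affine combination of points in
  degree 1 stays in degree 1.\<close>

lemma int_affine_hull_lattice_split:
  fixes P Q :: "(real ^ 'm) set"
  assumes "p0 \<in> P" "p0 \<in> Q"
    and y: "y \<in> int_affine_hull ((affine hull P \<union> affine hull Q) \<inter> int_lattice)"
  shows "(y, 1) \<in> {u + v |u v. u \<in> span (P \<times> {1}) \<inter> range embed \<and> v \<in> span (Q \<times> {1}) \<inter> range embed}"
    (is "_ \<in> ?G")
proof -
  obtain n :: nat and a :: "nat \<Rightarrow> int" and x
    where x: "\<And>i. i < n \<Longrightarrow> x i \<in> (affine hull P \<union> affine hull Q) \<inter> int_lattice"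
      and sum: "(\<Sum>i<n. a i) = 1" and y_eq: "y = (\<Sum>i<n. of_int (a i) *\<^sub>R x i)"
    using y unfolding int_affine_hull_def by blast
  have G_add: "z + z' \<in> ?G" if "z \<in> ?G" "z' \<in> ?G" for z z'
  proof -
    obtain u v where "z = u + v" "u \<in> span (P \<times> {1}) \<inter> range embed"
      "v \<in> span (Q \<times> {1}) \<inter> range embed"
      using \<open>z \<in> ?G\<close> by blast
    moreover obtain u' v' where "z' = u' + v'" "u' \<in> span (P \<times> {1}) \<inter> range embed"
      "v' \<in> span (Q \<times> {1}) \<inter> range embed"
      using \<open>z' \<in> ?G\<close> by blast
    ultimately have "z + z' = (u + u') + (v + v')" "u + u' \<in> span (P \<times> {1}) \<inter> range embed"
      "v + v' \<in> span (Q \<times> {1}) \<inter> range embed"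
      by (auto simp: span_add add_in_range_embed algebra_simps)
    then show ?thesis by blast
  qed
  have G0: "0 \<in> ?G"
    using zero_in_range_embed span_zero by (intro CollectI exI[of _ 0]) auto
  have mult: "of_int j *\<^sub>R (w, 1) \<in> range embed" if w: "w \<in> int_lattice" for w :: "real ^ 'm" and j :: int
  proof -
    obtain t where t: "w = vec_of_int t" using w by blast
    have "of_int j *\<^sub>R (w, 1) = embed (\<chi> i. j * t $ i, j)"
      by (simp add: embed_def t vec_of_int_def vec_eq_iff)
    then show ?thesis by blast
  qed
  have summand: "of_int (a i) *\<^sub>R (x i, 1) \<in> ?G" if "i < n" for i
  proof -
    have r: "of_int (a i) *\<^sub>R (x i, 1) \<in> range embed" using x[OF that] by (intro mult) auto
    have "(x i, 1) \<in> span (P \<times> {1::real}) \<or> (x i, 1) \<in> span (Q \<times> {1::real})"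
      using x[OF that] span_Times_1_iff[OF assms(1)] span_Times_1_iff[OF assms(2)] by blast
    then show ?thesis
    proof
      assume "(x i, 1) \<in> span (P \<times> {1::real})"
      then have "of_int (a i) *\<^sub>R (x i, 1) \<in> span (P \<times> {1::real})" by (rule span_mul)
      then show ?thesis
        using r zero_in_range_embed span_zero[of "Q \<times> {1::real}"]
        by (intro CollectI exI[of _ "of_int (a i) *\<^sub>R (x i, 1)"] exI[of _ 0]) simp
    next
      assume "(x i, 1) \<in> span (Q \<times> {1::real})"
      then have "of_int (a i) *\<^sub>R (x i, 1) \<in> span (Q \<times> {1::real})" by (rule span_mul)
      then show ?thesis
        using r zero_in_range_embed span_zero[of "P \<times> {1::real}"]
        by (intro CollectI exI[of _ 0] exI[of _ "of_int (a i) *\<^sub>R (x i, 1)"]) simp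
    qed
  qed
  have "(\<Sum>i\<in>I. of_int (a i) *\<^sub>R (x i, 1)) \<in> ?G" if "I \<subseteq> {..<n}" for I
    using finite_subset[OF that finite_lessThan] that
  proof (induction I)
    case empty
    show ?case using G0 by (simp only: sum.empty)
  next
    case (insert i I)
    then have "of_int (a i) *\<^sub>R (x i, 1) + (\<Sum>i\<in>I. of_int (a i) *\<^sub>R (x i, 1)) \<in> ?G"
      by (intro G_add summand) auto
    then show ?case using insert.hyps by (simp only: sum.insert not_False_eq_True)
  qed
  then have "(\<Sum>i<n. of_int (a i) *\<^sub>R (x i, 1)) \<in> ?G" by blast
  moreover have "(\<Sum>i<n. real_of_int (a i)) = 1"
    using sum by (simp flip: of_int_sum)
  then have "(\<Sum>i<n. of_int (a i) *\<^sub>R (x i, 1::real)) = (y, 1)"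
    by (simp add: prod_eq_iff fst_sum snd_sum y_eq)
  ultimately show ?thesis by simp
qed

lemma embed_iterate_int:
  assumes "embed a = embed a' + of_int n *\<^sub>R embed c"
  shows "\<exists>m. a = (((+) c) ^^ m) a' \<or> a' = (((+) c) ^^ m) a"
proof (cases n rule: int_cases2)
  case (nonneg m)
  then have "embed a = embed ((((+) c) ^^ m) a')" using assms by (simp add: embed_iterate)
  then show ?thesis using embed_eq_iff by blast
next
  case (nonpos m)
  then have "embed a' = embed ((((+) c) ^^ m) a)" using assms by (simp add: embed_iterate)
  then show ?thesis using embed_eq_iff by blast
qed

lemma rational_polytope_convex_bounded: "rational_polytope P \<Longrightarrow> convex P \<and> bounded P"
  unfolding rational_polytope_def by (auto simp: finite_imp_bounded bounded_convex_hull)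

theorem corollary3p7:
  fixes P Q R :: "(real ^ 'm) set" and p0 :: "real ^ 'm" and k :: nat and q :: "int ^ 'm"
  assumes "rational_polytope P" and "rational_polytope Q"
    and "affine hull P \<inter> affine hull Q = {p0}" and "p0 \<in> P \<inter> Q"
    and "R = convex hull (P \<union> Q)"
    and "affine hull R \<inter> int_lattice \<noteq> {}"
    and "affine hull R \<inter> int_lattice =
           int_affine_hull ((affine hull P \<union> affine hull Q) \<inter> int_lattice)"
    and "k > 0" and "vec_of_int q = real k *\<^sub>R p0"
    and "\<And>j::nat. j > 0 \<Longrightarrow> real j *\<^sub>R p0 \<in> int_lattice \<Longrightarrow> k \<le> j"
  shows "height_le_1_over_all_facets (real_ehrhart_monoid P) (real k *\<^sub>R p0, real k) \<or>
         height_le_1_over_all_facets (real_ehrhart_monoid Q) (real k *\<^sub>R p0, real k)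
     \<longleftrightarrow> ehrhart_series R = (1 - monomial (q, k)) * ehrhart_series P * ehrhart_series Q"
proof -
  define e where "e = embed (q, int k)"
  have e_eq: "e = (real k *\<^sub>R p0, real k)" and e_p0: "e = real k *\<^sub>R (p0, 1)"
    using assms(9) by (simp_all add: e_def embed_def)
  have p0: "p0 \<in> P" "p0 \<in> Q" using assms(4) by auto
  have P: "convex P" "P \<noteq> {}" "bounded P" and Q: "convex Q" "Q \<noteq> {}" "bounded Q"
    using rational_polytope_convex_bounded[OF assms(1)] rational_polytope_convex_bounded[OF assms(2)] p0
    by auto
  have R: "convex R" "R \<noteq> {}" "bounded R" "p0 \<in> R"
    using P Q p0 by (auto simp: assms(5) bounded_convex_hull intro: hull_inc)
  obtain V where V: "lattice_cone (range embed) V" and CV: "convex_cone hull V = polytope_cone P"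
    using rational_polytope_lattice_cone[OF assms(1)] .
  obtain W where W: "lattice_cone (range embed) W" and CW: "convex_cone hull W = polytope_cone Q"
    using rational_polytope_lattice_cone[OF assms(2)] .
  interpret V: lattice_cone "range embed" V by (rule V)
  have CR: "polytope_cone R = {x + y |x y. x \<in> polytope_cone P \<and> y \<in> polytope_cone Q}"
    unfolding assms(5) polytope_cone_convex_hull Sigma_Un_distrib1 convex_cone_hull_Un
    unfolding polytope_cone_def by blast
  have CVW: "convex_cone hull (V \<union> W) = polytope_cone R"
    unfolding CR convex_cone_hull_Un CV CW by blast
  have span: "span V = span (P \<times> {1})" "span W = span (Q \<times> {1})" "span (V \<union> W) = span (R \<times> {1})"
    using CV CW CVW unfolding polytope_cone_def by (metis span_convex_cone_hull)+
  have "e \<in> polytope_cone S" if "p0 \<in> S" for S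
    unfolding e_p0 polytope_cone_def using that by (intro convex_cone_hull_mul hull_inc) auto
  then have eP: "e \<in> polytope_cone P" and eQ: "e \<in> polytope_cone Q" using p0 by auto
  have e_lattice: "e \<in> range embed" by (simp add: e_def)
  have line: "span V \<inter> span W \<subseteq> range (\<lambda>t. t *\<^sub>R e)"
  proof
    fix z assume "z \<in> span V \<inter> span W"
    then obtain t where "z = t *\<^sub>R (p0, 1)"
      using span_Int_eq_line[OF assms(3,4)] unfolding span by blast
    then have "z = (t / real k) *\<^sub>R e" using assms(8) by (simp add: e_eq)
    then show "z \<in> range (\<lambda>t. t *\<^sub>R e)" by blast
  qed
  have primitive: "t \<in> \<int>" if t: "t *\<^sub>R e \<in> range embed" for t
  proof (rule ccontr)
    assume "t \<notin> \<int>"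
    then have frac: "0 < frac t" "frac t < 1" by (simp_all add: frac_lt_1)
    \<comment> \<open>The fractional part of \<open>t\<close> yields a lattice point on the line whose degree lies strictly
      between \<open>0\<close> and \<open>k\<close>, contrary to the minimality of \<open>k\<close>.\<close>
    have "t *\<^sub>R e - of_int \<lfloor>t\<rfloor> *\<^sub>R e \<in> range embed"
      using t e_lattice by (intro V.lattice_diff V.lattice_of_int)
    then have "frac t *\<^sub>R e \<in> range embed" by (simp add: frac_def scaleR_left_diff_distrib)
    then obtain y j where yj: "frac t *\<^sub>R e = embed (y, j)" by auto
    have y: "(frac t * real k) *\<^sub>R p0 = vec_of_int y"
      using arg_cong[OF yj, of fst] by (simp add: e_eq embed_def)
    have kj: "frac t * real k = of_int j"
      using arg_cong[OF yj, of snd] by (simp add: e_eq embed_def)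
    have "0 < real_of_int j" "real_of_int j < real k"
      using frac assms(8) by (simp_all flip: kj)
    then have j: "0 < nat j" "nat j < k" and "real (nat j) = real_of_int j" by auto
    moreover have "of_int j *\<^sub>R p0 = vec_of_int y" using y unfolding kj .
    ultimately have "real (nat j) *\<^sub>R p0 \<in> int_lattice" by simp
    then show False using assms(10)[OF j(1)] j(2) by simp
  qed
  have lattice_split: "\<exists>u\<in>span V \<inter> range embed. \<exists>v\<in>span W \<inter> range embed. z = u + v"
    if z: "z \<in> span (V \<union> W) \<inter> range embed" for z
  proof -
    \<comment> \<open>The hypothesis on the integral affine hull concerns degree 1. A lattice point \<open>y\<close> of the affine hull
      of \<open>R\<close> connects it with degree \<open>j\<close>: the point \<open>z - (j - 1)(y, 1)\<close> has degree 1.\<close>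
    obtain y where y: "y \<in> affine hull R" "y \<in> int_lattice" using assms(6) by blast
    obtain x j where xj: "z = embed (x, j)" using z by auto
    have y1: "(y, 1) \<in> span (R \<times> {1::real})" "(y, 1) \<in> range embed"
    proof -
      show "(y, 1) \<in> span (R \<times> {1::real})" using span_Times_1_iff[OF R(4)] y(1) by blast
      obtain y' where "y = vec_of_int y'" using y(2) by blast
      then have "(y, 1) = embed (y', 1)" by (simp add: embed_def)
      then show "(y, 1) \<in> range embed" by blast
    qed
    define w where "w = vec_of_int x - of_int (j - 1) *\<^sub>R y"
    have w1: "(w, 1) = z - of_int (j - 1) *\<^sub>R (y, 1)"
      by (simp add: w_def xj embed_def)
    have "(w, 1) \<in> span (R \<times> {1::real})"
      unfolding w1 using z y1(1) span(3) by (intro span_diff span_mul) auto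
    then have "w \<in> affine hull R" using span_Times_1_iff[OF R(4)] by blast
    moreover have "(w, 1) \<in> range embed"
      unfolding w1 using z y1(2) by (intro V.lattice_diff V.lattice_of_int) auto
    then have "w \<in> int_lattice" by (auto simp: embed_def)
    ultimately have "w \<in> int_affine_hull ((affine hull P \<union> affine hull Q) \<inter> int_lattice)"
      using assms(7) by blast
    from int_affine_hull_lattice_split[OF p0 this]
    obtain u v where uv: "(w, 1) = u + v" "u \<in> span V \<inter> range embed" "v \<in> span W \<inter> range embed"
      unfolding span by blast
    have "y \<in> int_affine_hull ((affine hull P \<union> affine hull Q) \<inter> int_lattice)"
      using assms(7) y by blast
    from int_affine_hull_lattice_split[OF p0 this]
    obtain u' v' where uv': "(y, 1) = u' + v'" "u' \<in> span V \<inter> range embed" "v' \<in> span W \<inter> range embed"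
      unfolding span by blast
    let ?u = "of_int (j - 1) *\<^sub>R u' + u" and ?v = "of_int (j - 1) *\<^sub>R v' + v"
    have "z = of_int (j - 1) *\<^sub>R (y, 1) + (w, 1)" using w1 by simp
    then have "z = ?u + ?v" unfolding uv(1) uv'(1) by (simp add: algebra_simps)
    moreover have "?u \<in> span V \<inter> range embed" "?v \<in> span W \<inter> range embed"
      using uv(2,3) uv'(2,3)
      by (blast intro: span_add span_mul V.lattice_add V.lattice_of_int)+
    ultimately show ?thesis by blast
  qed
  have mem: "a \<in> ehrhart_monoid P \<longleftrightarrow> embed a \<in> polytope_cone P"
    "a \<in> ehrhart_monoid Q \<longleftrightarrow> embed a \<in> polytope_cone Q"
    "a \<in> ehrhart_monoid R \<longleftrightarrow> embed a \<in> polytope_cone R" for a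
    by (simp_all add: ehrhart_monoid_eq P Q R)
  let ?sum = "{a + b |a b. a \<in> ehrhart_monoid P \<and> b \<in> ehrhart_monoid Q}"
  have sum_sub: "?sum \<subseteq> ehrhart_monoid R"
  proof
    fix c assume "c \<in> ?sum"
    then obtain a b where c: "c = a + b" and "embed a \<in> polytope_cone P" "embed b \<in> polytope_cone Q"
      using mem by blast
    then have "embed c \<in> polytope_cone R" unfolding CR c embed_add by blast
    then show "c \<in> ehrhart_monoid R" using mem(3) by blast
  qed
  have "height_le_1_over_all_facets (polytope_cone P \<inter> range embed) e \<or>
        height_le_1_over_all_facets (polytope_cone Q \<inter> range embed) e \<longleftrightarrow>
        polytope_cone R \<inter> range embed =
          {x + y |x y. x \<in> polytope_cone P \<inter> range embed \<and> y \<in> polytope_cone Q \<inter> range embed}"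
    using height_le_1_iff_lattice_points_add[OF V W _ _ e_lattice line primitive lattice_split] eP eQ
    unfolding CV CW CVW by blast
  also have "\<dots> \<longleftrightarrow> ehrhart_monoid R = ?sum"
  proof -
    have 1: "polytope_cone R \<inter> range embed = embed ` ehrhart_monoid R"
      using mem(3) by blast
    have 2: "{x + y |x y. x \<in> polytope_cone P \<inter> range embed \<and> y \<in> polytope_cone Q \<inter> range embed} = embed ` ?sum"
      (is "?l = ?r")
    proof
      show "?l \<subseteq> ?r"
      proof
        fix z assume "z \<in> ?l"
        then obtain a b where "embed a \<in> polytope_cone P" "embed b \<in> polytope_cone Q"
          and z: "z = embed a + embed b"
          by blast
        then have "a + b \<in> ?sum" using mem by blast
        then show "z \<in> ?r" unfolding z embed_add[symmetric] by (rule imageI)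
      qed
      show "?r \<subseteq> ?l"
      proof
        fix z assume "z \<in> ?r"
        then obtain a b where "a \<in> ehrhart_monoid P" "b \<in> ehrhart_monoid Q" and z: "z = embed (a + b)"
          by blast
        then show "z \<in> ?l" unfolding z embed_add using mem by blast
      qed
    qed
    have "inj embed" by (simp add: inj_def embed_eq_iff)
    then show ?thesis unfolding 1 2 by (rule inj_image_eq_iff)
  qed
  also have "\<dots> \<longleftrightarrow> set_series (ehrhart_monoid R) = set_series ?sum"
  proof (rule set_series_eq_iff[symmetric])
    show fin: "finite (degree_slice (ehrhart_monoid R) n)" for n
      by (rule finite_ehrhart_slice[OF R(3)])
    show "finite (degree_slice ?sum n)" for n
      unfolding degree_slice_def
      by (rule finite_subset[OF _ fin[of n, unfolded degree_slice_def]]) (use sum_sub in blast)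
    show "ehrhart_monoid R \<subseteq> UNIV \<times> {0..}" by (rule ehrhart_degree_nonneg)
    then show "?sum \<subseteq> UNIV \<times> {0..}" using sum_sub by blast
  qed
  also have "set_series ?sum = (1 - monomial (q, k)) * ehrhart_series P * ehrhart_series Q"
    unfolding ehrhart_series_eq
  proof (rule set_series_sumset[symmetric])
    show "(q, int k) + a \<in> ehrhart_monoid P" if "a \<in> ehrhart_monoid P" for a
      using that eP unfolding mem embed_add e_def[symmetric] polytope_cone_def by (intro convex_cone_hull_add)
    show "(q, int k) + a \<in> ehrhart_monoid Q" if "a \<in> ehrhart_monoid Q" for a
      using that eQ unfolding mem embed_add e_def[symmetric] polytope_cone_def by (intro convex_cone_hull_add)
    fix a b a' b'
    assume ab: "a \<in> ehrhart_monoid P" "b \<in> ehrhart_monoid Q" "a' \<in> ehrhart_monoid P" "b' \<in> ehrhart_monoid Q"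
      and "a + b = a' + b'"
    then have "a - a' = b' - b" by (simp add: algebra_simps)
    then have "embed a - embed a' = embed b' - embed b" by (metis embed_diff)
    moreover have "embed a - embed a' \<in> span V" "embed b' - embed b \<in> span W"
      using ab V.cone_subset_span lattice_cone.cone_subset_span[OF W] unfolding mem CV CW
      by (blast intro: span_diff)+
    ultimately obtain t where t: "embed a - embed a' = t *\<^sub>R e" using line by auto
    then have "t *\<^sub>R e \<in> range embed" by (metis embed_diff rangeI)
    then obtain n :: int where "t = of_int n" using primitive by (blast elim: Ints_cases)
    then have "embed a = embed a' + of_int n *\<^sub>R embed (q, int k)"
      using t by (simp add: e_def algebra_simps)
    then show "\<exists>n. a = (((+) (q, int k)) ^^ n) a' \<or> a' = (((+) (q, int k)) ^^ n) a"
      by (rule embed_iterate_int)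
  qed (fact assms(8) ehrhart_degree_nonneg finite_ehrhart_slice[OF P(3)] finite_ehrhart_slice[OF Q(3)])+
  finally show ?thesis
    unfolding ehrhart_series_eq[of R] real_ehrhart_monoid_eq[OF P(1,2)] real_ehrhart_monoid_eq[OF Q(1,2)] e_eq .
qed

end
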